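(* Let $A\in\mathcal M_m$ be a positive definite matrix and $q$ a real number with $0<q<1$. Put $\varphi(A)=\dfrac{I-A}{I+A}$ and write $$A^q=\left[I;\frac{I}{A_k}\right]_{k=1}^{+\infty},\qquad \ln A=\left[0;\frac{I}{\widetilde A_k}\right]_{k=1}^{+\infty},$$ where $$A_1=\frac{-I-q\varphi(A)}{2q\varphi(A)},\qquad A_2=\frac{-6qI}{(q^2-1)\varphi(A)},$$ $$A_{2k}=\frac{-2q(q^2-2^2)(q^2-4^2)\cdots(q^2-(2k-2)^2)}{(q^2-1)(q^2-3^2)\cdots(q^2-(2k-1)^2)}(4k-1)\,I\quad(k\ge2),$$ $$A_{2k+1}=\frac{-(q^2-1)(q^2-3^2)\cdots(q^2-(2k-1)^2)}{2q(q^2-2^2)(q^2-4^2)\cdots(q^2-4k^2)}(4k+1)\,\varphi^2(A)\quad(k\ge1),$$ and $$\widetilde A_1=(-2\varphi(A))^{-1},\qquad \widetilde A_2=\frac{6I}{\varphi(A)},$$ $$\widetilde A_{2k}=\frac{-2\,(2\cdot4\cdots(2k-2))^2}{(3\cdot5\cdots(2k-1))^2}(4k-1)\,I\quad(k\ge2),\qquad \widetilde A_{2k+1}=\frac{(1\cdot3\cdot5\cdots(2k-1))^2}{(2\cdot4\cdots(2k))^2\,\varphi(A)}(4k+1)\,I\quad(k\ge1).$$ Let $P_n,Q_n$ (resp. $\widetilde P_n,\widetilde Q_n$) be the numerator and denominator of the $n$-th convergent of $A^q$ (resp. $\ln A$), that is, for $n\ge1$, $$P_n=A_nP_{n-1}+P_{n-2},\quad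 Q_n=A_nQ_{n-1}+Q_{n-2},\qquad \widetilde P_n=\widetilde A_n\widetilde P_{n-1}+\widetilde P_{n-2},\quad \widetilde Q_n=\widetilde A_n\widetilde Q_{n-1}+\widetilde Q_{n-2},$$ with $P_{-1}=I$, $P_0=I$, $Q_{-1}=0$, $Q_0=I$ and $\widetilde P_{-1}=I$, $\widetilde P_0=0$, $\widetilde Q_{-1}=0$, $\widetilde Q_0=I$. Define, for $n\ge2$, $$E_n=Q_n\widetilde Q_n\big(Q_{n-2}P_{n-1}+\widetilde Q_{n-1}\widetilde P_{n-2}\big),\qquad F_n=Q_{n-2}\widetilde Q_{n-2}\big(Q_nP_{n-1}+\widetilde Q_{n-1}\widetilde P_n\big).$$ Then the continued fraction expansion of $A^q\ln(A)$ is given by $$A^q\ln(A)=\left[0;\frac{A_1+I}{A_1\widetilde A_1},\ \frac{(A_1A_2+I)(A_1+I)+\widetilde A_1\widetilde A_2}{(A_1A_2+A_2+I)\widetilde A_2},\ \frac{(A_1\widetilde A_1)^{-1}E_2F_3}{E_3-F_3},\ \frac{E_{n-1}F_n}{E_n-F_n}\right]_{n=4}^{+\infty}.$$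
   Context: $\mathcal M_m$ ($m\ge2$ an integer) is the algebra of real $m\times m$ matrices and $I$ is the identity matrix. For $X,Y\in\mathcal M_m$ with $Y$ invertible, $\frac XY$ means $Y^{-1}X$. For a positive definite $A$, $\ln A=-2\sum_{n\ge0}\frac1{2n+1}\left(\frac{I-A}{I+A}\right)^{2n+1}$ and $A^q=\exp(q\ln A)$. For sequences $(a_n)_{n\ge0}$, $(b_n)_{n\ge1}$ in $\mathcal M_m$, the continued fraction $\left[a_0;\frac{b_1}{a_1},\frac{b_2}{a_2},\dots\right]=\left[a_0;\frac{b_n}{a_n}\right]_{n=1}^{+\infty}$ has $n$-th convergent $\frac{U_n}{V_n}=V_n^{-1}U_n$, where $U_{-1}=I$, $U_0=a_0$, $V_{-1}=0$, $V_0=I$, and $U_n=a_nU_{n-1}+b_nU_{n-2}$, $V_n=a_nV_{n-1}+b_nV_{n-2}$ for $n\ge1$; $U_n$ and $V_n$ are called its numerator and denominator. The partial quotients $\frac{b_n}{a_n}$ are regarded as (numerator, denominator) pairs. The continued fraction equals $F\in\mathcal M_m$ if $\|V_n^{-1}U_n-F\|\to0$. In $[a_0;\frac{b_1}{a_1},\frac{b_2}{a_2},\frac{b_3}{a_3},\frac{b_n}{a_n}]_{n=4}^{+\infty}$ the first three partial quotients are listed and the last expression gives the $n$-th one for all $n\ge4$.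
   Formalization: From index 3 on the coefficients are corrected: A_{2k}, A_{2k+1}, Ã_{2k} carry φ(A)^{-1}, Ã_{2k} has sign +, Ã_{2k+1} an extra factor -1/2; printed ones only conditionally. φ(A) and all denominators of the product fraction are assumed invertible. *)

theory Defs
  imports "HOL-Analysis.Analysis"
begin

text \<open>
  The algebra of real m x m matrices is \<open>real^'n^'n\<close> with \<open>m = CARD('n)\<close>. On this type
  \<open>**\<close> is the matrix product, \<open>mat 1\<close> is the identity and \<open>norm\<close> is the Frobenius norm (all norms
  on this finite-dimensional space being equivalent). The type class operations \<open>*\<close>, \<open>^\<close> and
  \<open>exp\<close> are not the matrix operations, hence the definitions below.
\<close>

definition positive_definite :: "real^'n^'n \<Rightarrow> bool" where
  "positive_definite A \<longleftrightarrow> transpose A = A \<and> (\<forall>x. x \<noteq> 0 \<longrightarrow> 0 < x \<bullet> (A *v x))"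

text \<open>The fraction X/Y is the product of the inverse of Y with X, in this order. It is meaningful
  only if Y is invertible.\<close>

definition mfrac :: "real^'n^'n \<Rightarrow> real^'n^'n \<Rightarrow> real^'n^'n" where
  "mfrac X Y = matrix_inv Y ** X"

primrec mat_pow :: "real^'n^'n \<Rightarrow> nat \<Rightarrow> real^'n^'n" where
  "mat_pow X 0 = mat 1"
| "mat_pow X (Suc k) = X ** mat_pow X k"

definition mat_exp :: "real^'n^'n \<Rightarrow> real^'n^'n" where
  "mat_exp X = (\<Sum>k. (1 / fact k) *\<^sub>R mat_pow X k)"

definition phi :: "real^'n^'n \<Rightarrow> real^'n^'n" where
  "phi A = mfrac (mat 1 - A) (mat 1 + A)"

definition mat_ln :: "real^'n^'n \<Rightarrow> real^'n^'n" where
  "mat_ln A = (-2) *\<^sub>R (\<Sum>n. (1 / (2 * real n + 1)) *\<^sub>R mat_pow (phi A) (2 * n + 1))"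

definition mat_powr :: "real^'n^'n \<Rightarrow> real \<Rightarrow> real^'n^'n" where
  "mat_powr A q = mat_exp (q *\<^sub>R mat_ln A)"


section \<open>Matrix continued fractions\<close>

text \<open>A continued fraction is given by the sequence \<open>a\<close> of its partial denominators, with \<open>a 0\<close> the
  initial term, and the sequence \<open>b\<close> of its partial numerators, of which \<open>b 0\<close> is not used. The
  second equations contain the values at index -1, which are \<open>mat 1\<close> and \<open>0\<close>.\<close>

fun cf_num :: "(nat \<Rightarrow> real^'n^'n) \<Rightarrow> (nat \<Rightarrow> real^'n^'n) \<Rightarrow> nat \<Rightarrow> real^'n^'n" where
  "cf_num a b 0 = a 0"
| "cf_num a b (Suc 0) = a 1 ** cf_num a b 0 + b 1 ** mat 1"
| "cf_num a b (Suc (Suc n)) =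
     a (Suc (Suc n)) ** cf_num a b (Suc n) + b (Suc (Suc n)) ** cf_num a b n"

fun cf_den :: "(nat \<Rightarrow> real^'n^'n) \<Rightarrow> (nat \<Rightarrow> real^'n^'n) \<Rightarrow> nat \<Rightarrow> real^'n^'n" where
  "cf_den a b 0 = mat 1"
| "cf_den a b (Suc 0) = a 1 ** cf_den a b 0 + b 1 ** 0"
| "cf_den a b (Suc (Suc n)) =
     a (Suc (Suc n)) ** cf_den a b (Suc n) + b (Suc (Suc n)) ** cf_den a b n"

text \<open>All convergents are meaningful.\<close>

definition cf_defined :: "(nat \<Rightarrow> real^'n^'n) \<Rightarrow> (nat \<Rightarrow> real^'n^'n) \<Rightarrow> bool" where
  "cf_defined a b \<longleftrightarrow> (\<forall>n. invertible (cf_den a b n))"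

definition cf_equals :: "(nat \<Rightarrow> real^'n^'n) \<Rightarrow> (nat \<Rightarrow> real^'n^'n) \<Rightarrow> real^'n^'n \<Rightarrow> bool" where
  "cf_equals a b F \<longleftrightarrow> cf_defined a b \<and>
     (\<lambda>n. norm (mfrac (cf_num a b n) (cf_den a b n) - F)) \<longlonglongrightarrow> 0"

abbreviation ones :: "nat \<Rightarrow> real^'n^'n" where
  "ones \<equiv> (\<lambda>_. mat 1)"


section \<open>The expansions of the power and of the logarithm\<close>

text \<open>\<open>evens q k\<close> is the product of the \<open>q^2 - (2j)^2\<close> and \<open>odds q k\<close> that of the
  \<open>q^2 - (2j-1)^2\<close>, for j from 1 to k.\<close>

definition evens :: "real \<Rightarrow> nat \<Rightarrow> real" where
  "evens q k = (\<Prod>j=1..k. q\<^sup>2 - (2 * real j)\<^sup>2)"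

definition odds :: "real \<Rightarrow> nat \<Rightarrow> real" where
  "odds q k = (\<Prod>j=1..k. q\<^sup>2 - (2 * real j - 1)\<^sup>2)"

text \<open>
  \<open>pow_den\<close> and \<open>ln_den\<close> arise by an equivalence transformation to unit partial numerators from
  the classical expansions (x standing for \<open>phi A\<close>)
    \<open>A^q = 1 - 2qx/(1 + qx + (q^2-1)x^2/(3 + (q^2-4)x^2/(5 + (q^2-9)x^2/(7 + ...))))\<close>,
    \<open>ln A = -2x/(1 - x^2/(3 - 4x^2/(5 - 9x^2/(7 - ...))))\<close>.

  The primed versions are the coefficients as printed in the source. Both versions agree at the
  indices 1 and 2. From index 3 on the source has misprints: for the power, it lacks the inverse of
  \<open>phi A\<close> at even indices and has the square of \<open>phi A\<close> in its place at odd indices; for the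
  logarithm, it lacks the inverse of \<open>phi A\<close> and has the wrong sign at even indices, and lacks the
  factor -1/2 at odd indices. With the printed coefficients, the limits in general are not the power
  and the logarithm.
\<close>

definition pow_den :: "real \<Rightarrow> real^'n^'n \<Rightarrow> nat \<Rightarrow> real^'n^'n" where
  "pow_den q A n =
    (let k = n div 2 in
     if n = 0 then mat 1
     else if n = 1 then mfrac (- mat 1 - q *\<^sub>R phi A) ((2 * q) *\<^sub>R phi A)
     else if n = 2 then mfrac ((- 6 * q) *\<^sub>R mat 1) ((q\<^sup>2 - 1) *\<^sub>R phi A)
     else if even n then
       mfrac ((- 2 * q * evens q (k - 1) / odds q k * (4 * real k - 1)) *\<^sub>R mat 1) (phi A)
     else
       mfrac ((- odds q k / (2 * q * evens q k) * (4 * real k + 1)) *\<^sub>R mat 1) (phi A))"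

definition pow_den' :: "real \<Rightarrow> real^'n^'n \<Rightarrow> nat \<Rightarrow> real^'n^'n" where
  "pow_den' q A n =
    (let k = n div 2 in
     if n = 0 then mat 1
     else if n = 1 then mfrac (- mat 1 - q *\<^sub>R phi A) ((2 * q) *\<^sub>R phi A)
     else if n = 2 then mfrac ((- 6 * q) *\<^sub>R mat 1) ((q\<^sup>2 - 1) *\<^sub>R phi A)
     else if even n then
       (- 2 * q * evens q (k - 1) / odds q k * (4 * real k - 1)) *\<^sub>R mat 1
     else
       (- odds q k / (2 * q * evens q k) * (4 * real k + 1)) *\<^sub>R mat_pow (phi A) 2)"

definition ln_den :: "real^'n^'n \<Rightarrow> nat \<Rightarrow> real^'n^'n" where
  "ln_den A n =
    (let k = n div 2 in
     if n = 0 then 0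
     else if n = 1 then matrix_inv ((- 2) *\<^sub>R phi A)
     else if n = 2 then mfrac (6 *\<^sub>R mat 1) (phi A)
     else if even n then
       mfrac ((2 * (\<Prod>j=1..k-1. 2 * real j)\<^sup>2 / (\<Prod>j=1..k. 2 * real j - 1)\<^sup>2
                * (4 * real k - 1)) *\<^sub>R mat 1) (phi A)
     else
       mfrac ((- (\<Prod>j=1..k. 2 * real j - 1)\<^sup>2 / (2 * (\<Prod>j=1..k. 2 * real j)\<^sup>2)
                * (4 * real k + 1)) *\<^sub>R mat 1) (phi A))"

definition ln_den' :: "real^'n^'n \<Rightarrow> nat \<Rightarrow> real^'n^'n" where
  "ln_den' A n =
    (let k = n div 2 in
     if n = 0 then 0
     else if n = 1 then matrix_inv ((- 2) *\<^sub>R phi A)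
     else if n = 2 then mfrac (6 *\<^sub>R mat 1) (phi A)
     else if even n then
       (- 2 * (\<Prod>j=1..k-1. 2 * real j)\<^sup>2 / (\<Prod>j=1..k. 2 * real j - 1)\<^sup>2
          * (4 * real k - 1)) *\<^sub>R mat 1
     else
       (4 * real k + 1) *\<^sub>R
         mfrac ((\<Prod>j=1..k. 2 * real j - 1)\<^sup>2 *\<^sub>R mat 1)
               ((\<Prod>j=1..k. 2 * real j)\<^sup>2 *\<^sub>R phi A))"


section \<open>The product continued fraction\<close>

text \<open>Here \<open>a\<close> and \<open>c\<close> are the partial denominators of two continued fractions with unit partial
  numerators. \<open>E_term\<close> and \<open>F_term\<close> are used only for indices at least 2.\<close>

definition E_term :: "(nat \<Rightarrow> real^'n^'n) \<Rightarrow> (nat \<Rightarrow> real^'n^'n) \<Rightarrow> nat \<Rightarrow> real^'n^'n" where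
  "E_term a c n =
     cf_den a ones n ** cf_den c ones n **
       (cf_den a ones (n - 2) ** cf_num a ones (n - 1)
        + cf_den c ones (n - 1) ** cf_num c ones (n - 2))"

definition F_term :: "(nat \<Rightarrow> real^'n^'n) \<Rightarrow> (nat \<Rightarrow> real^'n^'n) \<Rightarrow> nat \<Rightarrow> real^'n^'n" where
  "F_term a c n =
     cf_den a ones (n - 2) ** cf_den c ones (n - 2) **
       (cf_den a ones n ** cf_num a ones (n - 1)
        + cf_den c ones (n - 1) ** cf_num c ones n)"

definition prod_num :: "(nat \<Rightarrow> real^'n^'n) \<Rightarrow> (nat \<Rightarrow> real^'n^'n) \<Rightarrow> nat \<Rightarrow> real^'n^'n" where
  "prod_num a c n =
    (if n = 0 then 0
     else if n = 1 then a 1 + mat 1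
     else if n = 2 then (a 1 ** a 2 + mat 1) ** (a 1 + mat 1) + c 1 ** c 2
     else if n = 3 then matrix_inv (a 1 ** c 1) ** E_term a c 2 ** F_term a c 3
     else E_term a c (n - 1) ** F_term a c n)"

definition prod_den :: "(nat \<Rightarrow> real^'n^'n) \<Rightarrow> (nat \<Rightarrow> real^'n^'n) \<Rightarrow> nat \<Rightarrow> real^'n^'n" where
  "prod_den a c n =
    (if n = 0 then 0
     else if n = 1 then a 1 ** c 1
     else if n = 2 then (a 1 ** a 2 + a 2 + mat 1) ** c 2
     else E_term a c n - F_term a c n)"

end

theory Submission
  imports Defs
begin

text \<open>
  In an orthonormal eigenbasis of \<open>A\<close> all matrices are diagonal, so everything reduces to scalars: to an
  eigenvalue \<open>x\<close> of \<open>phi A\<close> with \<open>0 < \<bar>x\<bar> < 1\<close>.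

  Let \<open>h\<close> be a convergent of the expansion of the logarithm (and put \<open>q = 0\<close>), or let \<open>1 + q h\<close> be one of the
  expansion of the power. Then \<open>h\<close> satisfies the Riccati equation \<open>(1 - x^2) h' = - 2 - 2 q h\<close> of its limit
  up to the term \<open>2 x^(2 n) \<Prod> (j^2 - q^2) / D^2\<close>, where \<open>D\<close> is the denominator. As \<open>D\<close> is at least
  \<open>\<Prod> (j - q)\<close>, this term tends to 0, and integration bounds the error.

  For the product, let \<open>u n\<close> and \<open>v n\<close> be the products of the numerators and of the denominators, and
  let \<open>g n\<close> be \<open>P (n - 1) Q n + P' n Q' (n - 1)\<close>. By the determinant formula \<open>g n\<close> is, up to its sign,
  the determinant \<open>u n v (n - 1) - u (n - 1) v n\<close>; moreover \<open>E n = v n g (n - 1)\<close> and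
  \<open>F n = v (n - 2) g n\<close>. Hence the product fraction is equivalent to the fraction whose convergents are
  the quotients \<open>u n / v n\<close>.
\<close>

section \<open>Convergence of the scalar expansions\<close>

text \<open>The \<open>n\<close>-th convergent of the classical fraction for \<open>((1 - x) / (1 + x)) powr q\<close> is
  \<open>1 + q * pade_num q x n / pade_den q x n\<close>. Splitting off the factor \<open>q\<close> makes \<open>q = 0\<close> admissible, where
  \<open>pade_num 0 x n / pade_den 0 x n\<close> is the convergent of \<open>ln ((1 - x) / (1 + x))\<close>.\<close>

fun pade_den :: "real \<Rightarrow> real \<Rightarrow> nat \<Rightarrow> real" where
  "pade_den q x 0 = 1"
| "pade_den q x (Suc 0) = 1 + q * x"
| "pade_den q x (Suc (Suc n)) =
     (2 * real n + 3) * pade_den q x (Suc n) - ((real n + 1)\<^sup>2 - q\<^sup>2) * x\<^sup>2 * pade_den q x n"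

fun pade_num :: "real \<Rightarrow> real \<Rightarrow> nat \<Rightarrow> real" where
  "pade_num q x 0 = 0"
| "pade_num q x (Suc 0) = - 2 * x"
| "pade_num q x (Suc (Suc n)) =
     (2 * real n + 3) * pade_num q x (Suc n) - ((real n + 1)\<^sup>2 - q\<^sup>2) * x\<^sup>2 * pade_num q x n"

lemma pade_num_0 [simp]: "pade_num q 0 n = 0"
  by (induction q "0::real" n rule: pade_num.induct) auto

text \<open>Write \<open>D\<close> for the denominators and k = n + 1. As |x| < 1, the subtracted
  term of the recurrence is at most (k + q) (k - q) D n, hence at most (k + q) D (n + 1) by the
  induction hypothesis. Of the coefficient 2 k + 1 there remains k + 1 - q. Positivity is carried
  along because the estimate multiplies by D n.\<close>

lemma pade_den_growth:
  assumes q: "0 \<le> q" "q < 1" and x: "\<bar>x\<bar> < 1"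
  shows "0 < pade_den q x n \<and> (real n + 1 - q) * pade_den q x n \<le> pade_den q x (Suc n)"
proof (induction n)
  case 0
  have "q * - 1 \<le> q * x"
    using x q by (intro mult_left_mono) auto
  then show ?case by simp
next
  case (Suc n)
  let ?k = "real n + 1"
  have pos: "0 < pade_den q x (Suc n)"
    using Suc q by (smt (verit) mult_pos_pos of_nat_0_le_iff)
  have "x\<^sup>2 \<le> 1" using x by (simp add: abs_square_le_1)
  moreover have "q\<^sup>2 \<le> ?k\<^sup>2" using q by (intro power_mono) auto
  ultimately have "(?k\<^sup>2 - q\<^sup>2) * x\<^sup>2 * pade_den q x n \<le> (?k\<^sup>2 - q\<^sup>2) * 1 * pade_den q x n"
    using Suc by (intro mult_right_mono mult_left_mono) auto
  also have "\<dots> = (?k + q) * ((?k - q) * pade_den q x n)"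
    by (simp add: power2_eq_square algebra_simps)
  also have "\<dots> \<le> (?k + q) * pade_den q x (Suc n)"
    using Suc q by (intro mult_left_mono) auto
  finally show ?case
    using pos by (simp add: algebra_simps)
qed

lemma pade_den_pos: "0 \<le> q \<Longrightarrow> q < 1 \<Longrightarrow> \<bar>x\<bar> < 1 \<Longrightarrow> 0 < pade_den q x n"
  using pade_den_growth by blast

lemma pade_den_ge:
  assumes "0 \<le> q" "q < 1" "\<bar>x\<bar> < 1"
  shows "(\<Prod>j=1..n. real j - q) \<le> pade_den q x n"
proof (induction n)
  case (Suc n)
  have "(\<Prod>j=1..Suc n. real j - q) = (real n + 1 - q) * (\<Prod>j=1..n. real j - q)"
    by (simp add: add.commute)
  also have "\<dots> \<le> (real n + 1 - q) * pade_den q x n"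
    using Suc assms by (intro mult_left_mono) auto
  finally show ?case
    using pade_den_growth[OF assms, of n] by linarith
qed simp

text \<open>Both sequences solve the same recurrence, so each step multiplies their Casoratian by
  \<open>((n + 1)^2 - q^2) * x^2\<close>; it starts at \<open>- 2 * x\<close>.\<close>

lemma pade_determinant:
  "pade_num q x (Suc n) * pade_den q x n - pade_num q x n * pade_den q x (Suc n)
     = - 2 * x ^ (2 * n + 1) * (\<Prod>j=1..n. (real j)\<^sup>2 - q\<^sup>2)"
proof (induction n)
  case (Suc n)
  have "pade_num q x (Suc (Suc n)) * pade_den q x (Suc n)
          - pade_num q x (Suc n) * pade_den q x (Suc (Suc n))
        = ((real n + 1)\<^sup>2 - q\<^sup>2) * x\<^sup>2 *
          (pade_num q x (Suc n) * pade_den q x n - pade_num q x n * pade_den q x (Suc n))"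
    by (simp add: algebra_simps)
  then show ?case
    unfolding Suc by (simp add: power2_eq_square algebra_simps)
qed simp

text \<open>Solutions of the recurrence of the continuants also satisfy differential-difference equations, as
  the Jacobi polynomials do.\<close>

lemma ladder_deriv:
  fixes Y G :: "nat \<Rightarrow> real \<Rightarrow> real"
  assumes Y: "\<And>n t. Y (Suc (Suc n)) t =
      (2 * real n + 3) * Y (Suc n) t - ((real n + 1)\<^sup>2 - q\<^sup>2) * t\<^sup>2 * Y n t"
    and G: "\<And>n. G (Suc (Suc n)) x =
      (2 * real n + 3) * G (Suc n) x - ((real n + 1)\<^sup>2 - q\<^sup>2) * x\<^sup>2 * G n x"
    and Y0: "(Y 0 has_real_derivative 0) (at x)" "x * G 0 x + (c * x + 1) * Y 0 x = Y 1 x"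
    and Y1: "(Y 1 has_real_derivative d) (at x)"
      "(1 - x\<^sup>2) * d = G 1 x + (c - x) * Y 1 x + (1 - q\<^sup>2) * x * Y 0 x"
    and x: "x\<^sup>2 \<noteq> 1"
  shows "(Y (Suc n) has_real_derivative
      (G (Suc n) x + (c - (real n + 1) * x) * Y (Suc n) x
        + ((real n + 1)\<^sup>2 - q\<^sup>2) * x * Y n x) / (1 - x\<^sup>2)) (at x)"
proof -
  \<comment> \<open>Two ladder relations, proved jointly: \<open>P n\<close> expresses the
    derivative of \<open>Y n\<close>, and \<open>Q n\<close> that of \<open>Y (n + 1)\<close>,
    through \<open>Y n\<close> and \<open>Y (n + 1)\<close>. A factor \<open>x\<close> in
    \<open>P\<close> replaces a division, so that \<open>x = 0\<close> is covered.\<close>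
  define P where "P n d \<longleftrightarrow> (Y n has_real_derivative d) (at x) \<and>
    (1 - x\<^sup>2) * x * d = x * G n x + (c - real n * x) * x * Y n x
      + (2 * real n + 1) * Y n x - Y (Suc n) x" for n d
  define Q where "Q n d \<longleftrightarrow> (Y (Suc n) has_real_derivative d) (at x) \<and>
    (1 - x\<^sup>2) * d = G (Suc n) x + (c - (real n + 1) * x) * Y (Suc n) x
      + ((real n + 1)\<^sup>2 - q\<^sup>2) * x * Y n x" for n d
  have "(\<exists>d. P n d) \<and> (\<exists>d. Q n d)"
  proof (induction n)
    case 0
    have "P 0 0"
      using Y0 by (simp add: P_def algebra_simps)
    moreover have "Q 0 d"
      using Y1 by (simp add: Q_def)
    ultimately show ?case by blast
  next
    case (Suc n)
    then obtain d0 d1 where P: "P n d0" and Q: "Q n d1" by blast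
    \<comment> \<open>The recurrence for \<open>Y\<close> turns \<open>x\<close> times
      \<open>Q n\<close> into \<open>P (n + 1)\<close>.\<close>
    have "P (Suc n) d1"
    proof -
      have "(1 - x\<^sup>2) * d1 * x = (G (Suc n) x + (c - (real n + 1) * x) * Y (Suc n) x
          + ((real n + 1)\<^sup>2 - q\<^sup>2) * x * Y n x) * x"
        using Q by (simp add: Q_def)
      then show ?thesis
        using Q by (simp add: P_def Q_def Y algebra_simps power2_eq_square)
    qed
    moreover
    \<comment> \<open>This is the derivative of the recurrence. One factor \<open>x\<close> of
      \<open>x^2 * d0\<close> is used up by \<open>P n\<close>, the other one remains in
      \<open>Q (n + 1)\<close>.\<close>
    let ?d = "(2 * real n + 3) * d1 - ((real n + 1)\<^sup>2 - q\<^sup>2) * (2 * x * Y n x + x\<^sup>2 * d0)"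
    have "((\<lambda>t. (2 * real n + 3) * Y (Suc n) t - ((real n + 1)\<^sup>2 - q\<^sup>2) * t\<^sup>2 * Y n t)
        has_real_derivative ?d) (at x)"
      using P Q unfolding P_def Q_def
      by (auto intro!: derivative_eq_intros simp: algebra_simps)
    then have "(Y (Suc (Suc n)) has_real_derivative ?d) (at x)"
      by (simp flip: Y)
    moreover have "(1 - x\<^sup>2) * ?d = G (Suc (Suc n)) x
        + (c - (real n + 2) * x) * Y (Suc (Suc n)) x
        + ((real n + 2)\<^sup>2 - q\<^sup>2) * x * Y (Suc n) x"
    proof -
      define Z where "Z = Y (Suc n) x"
      have "(1 - x\<^sup>2) * ?d = (2 * real n + 3) * ((1 - x\<^sup>2) * d1)
          - ((real n + 1)\<^sup>2 - q\<^sup>2) * (2 * x * (1 - x\<^sup>2) * Y n x + x * ((1 - x\<^sup>2) * x * d0))"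
        by (simp add: algebra_simps power2_eq_square)
      also have "\<dots> = G (Suc (Suc n)) x
        + (c - (real n + 2) * x) * Y (Suc (Suc n)) x
        + ((real n + 2)\<^sup>2 - q\<^sup>2) * x * Z"
        using P Q unfolding P_def Q_def Y[of n] G Z_def
        by (simp only:) (simp add: algebra_simps power2_eq_square)
      finally show ?thesis unfolding Z_def .
    qed
    ultimately show ?case
      by (force simp: Q_def add.commute)
  qed
  then obtain d where "Q n d" by blast
  moreover have "1 - x\<^sup>2 \<noteq> 0" using x by simp
  ultimately show ?thesis
    unfolding Q_def by (metis nonzero_mult_div_cancel_left)
qed

lemma pade_den_deriv:
  assumes "x\<^sup>2 \<noteq> 1"
  shows "((\<lambda>x. pade_den q x (Suc n)) has_real_derivative
      ((q - (real n + 1) * x) * pade_den q x (Suc n)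
        + ((real n + 1)\<^sup>2 - q\<^sup>2) * x * pade_den q x n) / (1 - x\<^sup>2)) (at x)"
proof -
  have "((\<lambda>x. 1 + q * x) has_real_derivative q) (at x)"
    by (auto intro!: derivative_eq_intros)
  then show ?thesis
    using ladder_deriv[of "\<lambda>n x. pade_den q x n" q "\<lambda>_ _. 0" x q q n] assms
    by (simp add: algebra_simps power2_eq_square)
qed

text \<open>Here the source term is \<open>G = - 2 * pade_den\<close>, admissible because it solves
  the same recurrence, and \<open>c = - q\<close>. For the denominators it was \<open>G = 0\<close>
  and \<open>c = q\<close>.\<close>

lemma pade_num_deriv:
  assumes "x\<^sup>2 \<noteq> 1"
  shows "((\<lambda>x. pade_num q x (Suc n)) has_real_derivative
      (- 2 * pade_den q x (Suc n) + (- q - (real n + 1) * x) * pade_num q x (Suc n)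
        + ((real n + 1)\<^sup>2 - q\<^sup>2) * x * pade_num q x n) / (1 - x\<^sup>2)) (at x)"
proof -
  have "((\<lambda>x. - 2 * x) has_real_derivative - 2) (at x)"
    by (auto intro!: derivative_eq_intros)
  then show ?thesis
    using ladder_deriv[of "\<lambda>n x. pade_num q x n" q "\<lambda>n x. - 2 * pade_den q x n" x "- q" "-2" n] assms
    by (simp add: algebra_simps power2_eq_square)
qed

text \<open>This is the Riccati equation with its defect. In the quotient rule the terms with
  \<open>n + 1\<close> cancel, the two values of \<open>c\<close> differ by \<open>- 2 * q\<close>,
  the source term contributes \<open>- 2\<close>, and the cross terms form the Casoratian.\<close>

lemma pade_quotient_deriv:
  assumes "0 \<le> q" "q < 1" "\<bar>x\<bar> < 1"
  shows "((\<lambda>x. pade_num q x (Suc n) / pade_den q x (Suc n)) has_real_derivative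
     (2 * x ^ (2 * Suc n) * (\<Prod>j=1..Suc n. (real j)\<^sup>2 - q\<^sup>2) / (pade_den q x (Suc n))\<^sup>2
        - 2 - 2 * q * (pade_num q x (Suc n) / pade_den q x (Suc n))) / (1 - x\<^sup>2)) (at x)"
proof -
  let ?D = "pade_den q x" and ?M = "pade_num q x"
  let ?k = "(real n + 1)\<^sup>2 - q\<^sup>2"
  let ?D' = "((q - (real n + 1) * x) * ?D (Suc n) + ?k * x * ?D n) / (1 - x\<^sup>2)"
  let ?M' = "(- 2 * ?D (Suc n) + (- q - (real n + 1) * x) * ?M (Suc n) + ?k * x * ?M n) / (1 - x\<^sup>2)"
  have D: "?D (Suc n) \<noteq> 0"
    using pade_den_pos[OF assms] by (metis less_irrefl)
  have x: "x\<^sup>2 \<noteq> 1" using assms by (simp add: power2_eq_1_iff abs_less_iff)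
  then have nz: "1 - x\<^sup>2 \<noteq> 0" by simp
  have "2 * x ^ (2 * Suc n) * (\<Prod>j=1..Suc n. (real j)\<^sup>2 - q\<^sup>2)
      = - x * ?k * (- 2 * x ^ (2 * n + 1) * (\<Prod>j=1..n. (real j)\<^sup>2 - q\<^sup>2))"
    by (simp add: algebra_simps)
  also have "\<dots> = - x * ?k * (?M (Suc n) * ?D n - ?M n * ?D (Suc n))"
    by (simp only: pade_determinant)
  finally have det: "2 * x ^ (2 * Suc n) * (\<Prod>j=1..Suc n. (real j)\<^sup>2 - q\<^sup>2)
      = - x * ?k * (?M (Suc n) * ?D n - ?M n * ?D (Suc n))" .
  have quot: "((\<lambda>x. pade_num q x (Suc n) / pade_den q x (Suc n)) has_real_derivative
      (?M' * ?D (Suc n) - ?M (Suc n) * ?D') / (?D (Suc n) * ?D (Suc n))) (at x)"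
    by (intro DERIV_divide pade_num_deriv pade_den_deriv x D)
  have alg: "((- 2 * b + (- q - c * x) * m + k * x * m') / u * b - m * (((q - c * x) * b + k * x * b') / u))
        / (b * b)
      = (- x * k * (m * b' - m' * b) / b\<^sup>2 - 2 - 2 * q * (m / b)) / u"
    if "b \<noteq> 0" "u \<noteq> 0" for b b' m m' k u c :: real
    using that by (simp add: field_simps power2_eq_square)
  show ?thesis
    using quot unfolding det alg[OF D nz] .
qed

text \<open>The quotient of consecutive terms is r (j + q) / (j - q) with j = n + 1. It tends to r <
  1, so the ratio test applies, with the midpoint of r and 1 as its constant.\<close>

lemma prod_ratio_tendsto_0:
  fixes q r :: real
  assumes q: "0 \<le> q" "q < 1" and r: "0 \<le> r" "r < 1"
  shows "(\<lambda>n. r ^ n * (\<Prod>j=1..n. (real j)\<^sup>2 - q\<^sup>2) / (\<Prod>j=1..n. real j - q)\<^sup>2) \<longlonglongrightarrow> 0"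
proof -
  let ?f = "\<lambda>n. r ^ n * (\<Prod>j=1..n. (real j)\<^sup>2 - q\<^sup>2) / (\<Prod>j=1..n. real j - q)\<^sup>2"
  have step: "?f (Suc n) = r * ((real n + 1 + q) / (real n + 1 - q)) * ?f n" for n
  proof -
    have "?f (Suc n) = r * (((real n + 1)\<^sup>2 - q\<^sup>2) / (real n + 1 - q)\<^sup>2) * ?f n"
    proof -
      have "(\<Prod>j=1..Suc n. (real j)\<^sup>2 - q\<^sup>2) = ((real n + 1)\<^sup>2 - q\<^sup>2) * (\<Prod>j=1..n. (real j)\<^sup>2 - q\<^sup>2)"
        "(\<Prod>j=1..Suc n. real j - q) = (real n + 1 - q) * (\<Prod>j=1..n. real j - q)"
        by (simp_all add: add.commute)
      then show ?thesis
        unfolding power_Suc by (simp add: power_mult_distrib del: prod.cl_ivl_Suc)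
    qed
    also have "((real n + 1)\<^sup>2 - q\<^sup>2) / (real n + 1 - q)\<^sup>2 = (real n + 1 + q) / (real n + 1 - q)"
      using q by (simp add: power2_eq_square square_diff_square_factored)
    finally show ?thesis .
  qed
  define c where "c = (r + 1) / 2"
  have c: "r < c" "c < 1" using r by (auto simp: c_def)
  have "(\<lambda>n. r * (1 + 2 * q / (1 - q + real n))) \<longlonglongrightarrow> r * (1 + 0)"
    by (intro tendsto_intros tendsto_divide_0[OF tendsto_const] filterlim_at_top_imp_at_infinity
        filterlim_tendsto_add_at_top[OF tendsto_const] filterlim_real_sequentially)
  moreover have "1 + 2 * q / (1 - q + real n) = (real n + 1 + q) / (real n + 1 - q)" for n
    using q by (simp add: field_simps)
  ultimately have "(\<lambda>n. r * ((real n + 1 + q) / (real n + 1 - q))) \<longlonglongrightarrow> r"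
    by simp
  then have "eventually (\<lambda>n. r * ((real n + 1 + q) / (real n + 1 - q)) < c) sequentially"
    using c by (intro order_tendstoD) auto
  then obtain N where N: "\<And>n. n \<ge> N \<Longrightarrow> r * ((real n + 1 + q) / (real n + 1 - q)) < c"
    by (auto simp: eventually_sequentially)
  have "summable ?f"
  proof (rule summable_ratio_test[OF c(2), of N])
    fix n assume "n \<ge> N"
    then have "\<bar>r * ((real n + 1 + q) / (real n + 1 - q))\<bar> * \<bar>?f n\<bar> \<le> c * \<bar>?f n\<bar>"
      using N[of n] r q by (intro mult_right_mono) auto
    then show "norm (?f (Suc n)) \<le> c * norm (?f n)"
      unfolding step by (simp only: real_norm_def abs_mult)
  qed
  then show ?thesis by (rule summable_LIMSEQ_zero)
qed

text \<open>The error of a convergent, multiplied by the integrating factor \<open>((1 + t) / (1 - t)) powr q\<close>, has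
  an explicit derivative, which tends to 0 uniformly on compact subsets of the open unit interval.\<close>

lemma pade_quotient_tendsto:
  assumes q: "0 \<le> q" "q < 1" and x: "\<bar>x\<bar> < 1"
    and H: "\<And>t. \<bar>t\<bar> < 1 \<Longrightarrow> (H has_real_derivative (- 2 - 2 * q * H t) / (1 - t\<^sup>2)) (at t)"
      "H 0 = 0"
  shows "(\<lambda>n. pade_num q x n / pade_den q x n) \<longlonglongrightarrow> H x"
proof -
  \<comment> \<open>Integrating factor: \<open>w' / w = 2 * q / (1 - t^2)\<close> cancels the linear
    term in the difference of the two Riccati equations.\<close>
  define w where "w t = exp (q * (ln (1 + t) - ln (1 - t)))" for t
  define r where "r = \<bar>x\<bar>"
  define C where "C = 2 * w r / (1 - r\<^sup>2)"
  have r: "0 \<le> r" "r < 1" using x by (auto simp: r_def)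
  have r2: "r\<^sup>2 < 1" using r by (simp add: power_less_one_iff abs_square_less_1)
  define e where "e n t = w t * (pade_num q t n / pade_den q t n - H t)" for n t
  define R where "R n = (r\<^sup>2) ^ n * (\<Prod>j=1..n. (real j)\<^sup>2 - q\<^sup>2) / (\<Prod>j=1..n. real j - q)\<^sup>2" for n
  define e' where "e' n t = w t / (1 - t\<^sup>2) * (2 * t ^ (2 * n) * (\<Prod>j=1..n. (real j)\<^sup>2 - q\<^sup>2) / (pade_den q t n)\<^sup>2)"
    for n t
  have w': "(w has_real_derivative w t * (2 * q / (1 - t\<^sup>2))) (at t)" if "\<bar>t\<bar> < 1" for t
  proof -
    have "1 - t\<^sup>2 = (1 + t) * (1 - t)" by (simp add: power2_eq_square algebra_simps)
    then have "1 / (1 + t) + 1 / (1 - t) = 2 / (1 - t\<^sup>2)"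
      using that by (simp add: field_simps)
    moreover have "(w has_real_derivative w t * (q * (1 / (1 + t) + 1 / (1 - t)))) (at t)"
      using that unfolding w_def by (auto intro!: derivative_eq_intros)
    ultimately show ?thesis by (simp add: algebra_simps)
  qed
  have e_deriv: "(e (Suc n) has_real_derivative e' (Suc n) t) (at t)" if t: "\<bar>t\<bar> < 1" for n t
  proof -
    have alg: "w * (2 * q / u) * (m - h) + ((X - 2 - 2 * q * m) / u - (- 2 - 2 * q * h) / u) * w
          = w / u * X" if "u \<noteq> 0" for w u m h X :: real
      using that by (simp add: field_simps)
    have "1 - t\<^sup>2 \<noteq> 0" using t by (simp add: power2_eq_1_iff abs_less_iff)
    note alg = alg[OF this]
    show ?thesis
      unfolding e_def e'_def
      using DERIV_mult[OF w'[OF t] DERIV_diff[OF pade_quotient_deriv[OF q t, of n] H(1)[OF t]]]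
      unfolding alg .
  qed
  have bound: "\<bar>e (Suc n) x\<bar> \<le> C * R (Suc n)" for n
  proof -
    \<comment> \<open>Mean value estimate on [-r, r], started at 0, where both the convergents and
      \<open>H\<close> vanish.\<close>
    have "norm (e (Suc n) x - e (Suc n) 0) \<le> (C * R (Suc n)) * norm (x - 0)"
    proof (rule field_differentiable_bound[of "{-r..r}"])
      fix t assume "t \<in> {-r..r}"
      then have t: "\<bar>t\<bar> \<le> r" "\<bar>t\<bar> < 1" using r by auto
      then show "(e (Suc n) has_real_derivative e' (Suc n) t) (at t within {-r..r})"
        by (auto intro: has_field_derivative_at_within[OF e_deriv])
      have t2: "t\<^sup>2 \<le> r\<^sup>2" using t r abs_le_square_iff[of t r] by simp
      \<comment> \<open>\<open>w\<close> is nondecreasing as \<open>q\<close> is nonnegative, so on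
        [-r, r] it is largest at \<open>r\<close>.\<close>
      have "w t \<le> w r"
        unfolding w_def using t r q by (auto intro!: mult_left_mono diff_mono)
      then have 1: "w t / (1 - t\<^sup>2) \<le> w r / (1 - r\<^sup>2)"
        using t2 r2 by (intro frac_le) (auto simp: w_def)
      have "0 < (\<Prod>j=1..Suc n. real j - q)"
        using q by (intro prod_pos) auto
      moreover note pade_den_ge[OF q t(2), of "Suc n"]
      moreover have "(\<Prod>j=1..Suc n. (real j)\<^sup>2 - q\<^sup>2) \<ge> 0"
        using q by (intro prod_nonneg) (auto intro!: power_mono)
      ultimately have 2: "(t\<^sup>2) ^ Suc n * (\<Prod>j=1..Suc n. (real j)\<^sup>2 - q\<^sup>2) / (pade_den q t (Suc n))\<^sup>2 \<le> R (Suc n)"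
        and 3: "0 \<le> (t\<^sup>2) ^ Suc n * (\<Prod>j=1..Suc n. (real j)\<^sup>2 - q\<^sup>2) / (pade_den q t (Suc n))\<^sup>2"
        unfolding R_def using t2
        by (auto simp only: zero_le_power2 intro!: frac_le mult_mono power_mono mult_nonneg_nonneg
            divide_nonneg_nonneg zero_le_power[OF zero_le_power2] zero_less_power)
      have eq: "e' (Suc n) t = 2 * (w t / (1 - t\<^sup>2)) * ((t\<^sup>2) ^ Suc n * (\<Prod>j=1..Suc n. (real j)\<^sup>2 - q\<^sup>2) / (pade_den q t (Suc n))\<^sup>2)"
        unfolding e'_def power_mult by simp
      have w0: "0 \<le> w t / (1 - t\<^sup>2)"
        using t2 r2 by (simp add: w_def)
      have "\<bar>e' (Suc n) t\<bar> = e' (Suc n) t"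
        unfolding eq using w0 3 by (intro abs_of_nonneg mult_nonneg_nonneg) auto
      also have "\<dots> \<le> 2 * (w r / (1 - r\<^sup>2)) * R (Suc n)"
        unfolding eq using 1 2 3 w0 by (intro mult_mono mult_nonneg_nonneg) auto
      finally show "norm (e' (Suc n) t) \<le> C * R (Suc n)"
        by (simp add: C_def)
    qed (use r in \<open>auto simp: r_def\<close>)
    also have "\<dots> \<le> (C * R (Suc n)) * 1"
    proof (rule mult_left_mono)
      have "C \<ge> 0" using r2 by (simp add: C_def w_def)
      moreover have "R (Suc n) \<ge> 0"
        unfolding R_def using q
        by (intro divide_nonneg_nonneg mult_nonneg_nonneg prod_nonneg) (auto intro!: power_mono)
      ultimately show "0 \<le> C * R (Suc n)" by simp
    qed (use x in auto)
    finally show ?thesis by (simp add: e_def H(2))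
  qed
  have "R \<longlonglongrightarrow> 0"
    unfolding R_def using q r2 by (intro prod_ratio_tendsto_0) auto
  then have "(\<lambda>n. C * R (Suc n)) \<longlonglongrightarrow> 0"
    by (intro tendsto_mult_right_zero LIMSEQ_Suc)
  then have "(\<lambda>n. e (Suc n) x) \<longlonglongrightarrow> 0"
    by (rule Lim_null_comparison[rotated]) (use bound in auto)
  then have "(\<lambda>n. e n x) \<longlonglongrightarrow> 0"
    by (rule LIMSEQ_imp_Suc)
  moreover have "w x \<noteq> 0" by (simp add: w_def)
  ultimately have "(\<lambda>n. e n x / w x + H x) \<longlonglongrightarrow> 0 / w x + H x"
    by (intro tendsto_intros)
  with \<open>w x \<noteq> 0\<close> show ?thesis
    by (simp add: e_def)
qed

text \<open>With y = ((1 - t) / (1 + t)) powr q one has y' = - 2 q y / (1 - t^2), so (y - 1) / q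
  solves the Riccati equation and vanishes at 0.\<close>

lemma pade_powr_tendsto:
  assumes q: "0 < q" "q < 1" and x: "\<bar>x\<bar> < 1"
  shows "(\<lambda>n. 1 + q * (pade_num q x n / pade_den q x n)) \<longlonglongrightarrow> exp (q * ln ((1 - x) / (1 + x)))"
proof -
  let ?H = "\<lambda>t. (exp (q * (ln (1 - t) - ln (1 + t))) - 1) / q"
  have "(\<lambda>n. pade_num q x n / pade_den q x n) \<longlonglongrightarrow> ?H x"
  proof (rule pade_quotient_tendsto[OF _ q(2) x])
    fix t :: real assume t: "\<bar>t\<bar> < 1"
    have "1 - t\<^sup>2 = (1 + t) * (1 - t)" by (simp add: power2_eq_square algebra_simps)
    then have *: "- 1 / (1 - t) - 1 / (1 + t) = - 2 / (1 - t\<^sup>2)"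
      using t by (simp add: field_simps)
    have "(?H has_real_derivative exp (q * (ln (1 - t) - ln (1 + t))) *
        (q * (- 1 / (1 - t) - 1 / (1 + t))) / q) (at t)"
      using t q by (auto intro!: derivative_eq_intros)
    moreover have "w * (q * (- 2 / u)) / q = (- 2 - 2 * q * ((w - 1) / q)) / u" for w u
      using q by (cases "u = 0") (simp_all add: field_simps)
    ultimately show "(?H has_real_derivative (- 2 - 2 * q * ?H t) / (1 - t\<^sup>2)) (at t)"
      unfolding * by simp
  qed (use q in auto)
  then have "(\<lambda>n. 1 + q * (pade_num q x n / pade_den q x n)) \<longlonglongrightarrow> 1 + q * ?H x"
    by (intro tendsto_add tendsto_mult tendsto_const)
  moreover have "ln ((1 - x) / (1 + x)) = ln (1 - x) - ln (1 + x)"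
    using x by (intro ln_divide_pos) auto
  ultimately show ?thesis using q by simp
qed

text \<open>For \<open>q = 0\<close> the Riccati equation degenerates to h' = - 2 / (1 -
  t^2).\<close>

lemma pade_ln_tendsto:
  assumes x: "\<bar>x\<bar> < 1"
  shows "(\<lambda>n. pade_num 0 x n / pade_den 0 x n) \<longlonglongrightarrow> ln ((1 - x) / (1 + x))"
proof -
  let ?H = "\<lambda>t::real. ln (1 - t) - ln (1 + t)"
  have "(\<lambda>n. pade_num 0 x n / pade_den 0 x n) \<longlonglongrightarrow> ?H x"
  proof (rule pade_quotient_tendsto[OF _ _ x])
    fix t :: real assume t: "\<bar>t\<bar> < 1"
    have "1 - t\<^sup>2 = (1 + t) * (1 - t)" by (simp add: power2_eq_square algebra_simps)
    then have *: "- 1 / (1 - t) - 1 / (1 + t) = - 2 / (1 - t\<^sup>2)"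
      using t by (simp add: field_simps)
    have "(?H has_real_derivative (- 1 / (1 - t) - 1 / (1 + t))) (at t)"
      using t by (auto intro!: derivative_eq_intros)
    then show "(?H has_real_derivative (- 2 - 2 * 0 * ?H t) / (1 - t\<^sup>2)) (at t)"
      unfolding * by simp
  qed auto
  moreover have "ln ((1 - x) / (1 + x)) = ln (1 - x) - ln (1 + x)"
    using x by (intro ln_divide_pos) auto
  ultimately show ?thesis by simp
qed


section \<open>The spectral theorem\<close>

text \<open>Variational argument: the eigenvector is a maximiser of the Rayleigh quotient on the
  unit sphere of \<open>U\<close>, and the eigenvalue is the maximum.\<close>

lemma symmetric_eigenvector:
  fixes A :: "real^'n^'n"
  assumes A: "transpose A = A" and U: "subspace U" "U \<noteq> {0}" and inv: "\<And>u. u \<in> U \<Longrightarrow> A *v u \<in> U"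
  obtains v c where "v \<in> U" "norm v = 1" "A *v v = c *\<^sub>R v"
proof -
  have sym: "x \<bullet> (A *v y) = (A *v x) \<bullet> y" for x y
    by (metis A dot_lmul_matrix vector_transpose_matrix)
  let ?S = "U \<inter> sphere 0 1"
  have "compact ?S"
    by (simp add: U(1) closed_subspace closed_Int_compact)
  moreover have "?S \<noteq> {}"
  proof -
    obtain u where "u \<in> U" "u \<noteq> 0"
      using U subspace_0 by blast
    then have "(1 / norm u) *\<^sub>R u \<in> ?S"
      using U(1) by (auto simp: subspace_scale)
    then show ?thesis by blast
  qed
  moreover have "continuous_on ?S (\<lambda>v. v \<bullet> (A *v v))"
    by (intro continuous_intros linear_continuous_on matrix_vector_mul_bounded_linear)
  ultimately obtain v where v: "v \<in> ?S" and max: "\<And>u. u \<in> ?S \<Longrightarrow> u \<bullet> (A *v u) \<le> v \<bullet> (A *v v)"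
    using continuous_attains_sup by (metis (lifting))
  define c where "c = v \<bullet> (A *v v)"
  have vv: "v \<bullet> v = 1" using v by (simp add: norm_eq_1)
  have max': "u \<bullet> (A *v u) \<le> c * (u \<bullet> u)" if "u \<in> U" for u
  proof (cases "u = 0")
    case False
    then have "(1 / norm u) *\<^sub>R u \<in> ?S"
      using U(1) that by (auto simp: subspace_scale)
    from max[OF this] have "(u \<bullet> (A *v u)) / (norm u)\<^sup>2 \<le> c"
      by (simp add: c_def matrix_vector_mult_scaleR power2_eq_square)
    then show ?thesis
      using False by (simp add: field_simps power2_norm_eq_inner)
  qed simp
  have orth: "w \<bullet> (A *v v) = 0" if w: "w \<in> U" "w \<bullet> v = 0" for w
  proof (rule ccontr)
    define a where "a = w \<bullet> (A *v v)"
    define b where "b = c * (w \<bullet> w) - w \<bullet> (A *v w)"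
    assume "w \<bullet> (A *v v) \<noteq> 0"
    then have a: "a\<^sup>2 > 0" by (simp add: a_def)
    \<comment> \<open>Maximality is tested on the perturbed vector \<open>v + t *\<^sub>R w\<close>;
      the terms of order 0 in \<open>t\<close> cancel.\<close>
    have quad: "2 * t * a \<le> t\<^sup>2 * b" for t
    proof -
      have "v + t *\<^sub>R w \<in> U"
        using U(1) w v by (simp add: subspace_add subspace_scale)
      from max'[OF this] have "c + 2 * t * a + t\<^sup>2 * (w \<bullet> (A *v w)) \<le> c * (1 + t\<^sup>2 * (w \<bullet> w))"
        using w(2) vv sym[of v w]
        by (simp add: matrix_vector_right_distrib matrix_vector_mult_scaleR inner_add_left
            inner_add_right c_def a_def power2_eq_square inner_commute algebra_simps)
      then show ?thesis by (simp add: b_def algebra_simps)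
    qed
    \<comment> \<open>The parameter \<open>t = s * a\<close> makes the linear term positive, and
      \<open>s\<close> is small enough for it to dominate the quadratic one.\<close>
    define s where "s = 1 / (\<bar>b\<bar> + 1)"
    have s: "s > 0" "s * b < 1"
      unfolding s_def by (auto simp: field_simps)
    have "2 * (s * a) * a \<le> (s * a)\<^sup>2 * b" by (rule quad)
    then have "s * a\<^sup>2 * 2 \<le> s * a\<^sup>2 * (s * b)"
      by (simp add: power2_eq_square algebra_simps)
    then have "2 \<le> s * b" using s a by simp
    then show False using s by simp
  qed
  define w where "w = A *v v - c *\<^sub>R v"
  have "w \<in> U" using v inv U(1) by (simp add: w_def subspace_diff subspace_scale)
  moreover have "w \<bullet> v = 0"
    by (simp only: w_def inner_diff_left inner_scaleR_left) (simp add: vv c_def inner_commute)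
  \<comment> \<open>Only one factor is expanded: \<open>w\<close> is orthogonal to
    \<open>A *v v\<close> by \<open>orth\<close>, and to \<open>v\<close>.\<close>
  ultimately have "w \<bullet> w = 0"
    using orth[of w] by (subst (2) w_def) (simp add: inner_diff_right)
  then have "A *v v = c *\<^sub>R v" by (simp add: w_def)
  with v that show ?thesis by auto
qed

text \<open>Induction on the dimension: a unit eigenvector \<open>v\<close> is split off, and by
  symmetry \<open>A\<close> preserves its orthogonal complement in \<open>U\<close>. Completeness of
  the basis is expressed by the expansion formula.\<close>

lemma symmetric_eigenbasis_subspace:
  fixes A :: "real^'n^'n"
  assumes A: "transpose A = A"
  shows "subspace U \<Longrightarrow> (\<And>u. u \<in> U \<Longrightarrow> A *v u \<in> U) \<Longrightarrow>
    \<exists>B. finite B \<and> B \<subseteq> U \<and> (\<forall>b\<in>B. norm b = 1 \<and> (\<exists>c. A *v b = c *\<^sub>R b)) \<and>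
      (\<forall>b\<in>B. \<forall>b'\<in>B. b \<noteq> b' \<longrightarrow> b \<bullet> b' = 0) \<and> (\<forall>u\<in>U. (\<Sum>b\<in>B. (b \<bullet> u) *\<^sub>R b) = u)"
proof (induction "dim U" arbitrary: U rule: less_induct)
  case less
  have sym: "x \<bullet> (A *v y) = (A *v x) \<bullet> y" for x y
    by (metis A dot_lmul_matrix vector_transpose_matrix)
  show ?case
  proof (cases "U = {0}")
    case True
    then show ?thesis by (intro exI[of _ "{}"]) auto
  next
    case False
    obtain v c where v: "v \<in> U" "norm v = 1" "A *v v = c *\<^sub>R v"
      using symmetric_eigenvector[OF A less.prems(1) False less.prems(2)] by blast
    have vv: "v \<bullet> v = 1" using v by (simp add: norm_eq_1)
    define W where "W = U \<inter> {w. v \<bullet> w = 0}"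
    have W: "subspace W"
      unfolding W_def by (intro subspace_inter less.prems subspace_hyperplane)
    have "v \<notin> W" using vv by (simp add: W_def)
    then have "W \<subset> U" using v(1) unfolding W_def by blast
    then have "dim W < dim U"
      using W less.prems(1) by (metis dim_psubset span_eq_iff)
    moreover have "A *v w \<in> W" if "w \<in> W" for w
      using that less.prems(2) by (simp add: W_def sym v)
    ultimately obtain B where B: "finite B" "B \<subseteq> W"
      "\<forall>b\<in>B. norm b = 1 \<and> (\<exists>c. A *v b = c *\<^sub>R b)"
      "\<forall>b\<in>B. \<forall>b'\<in>B. b \<noteq> b' \<longrightarrow> b \<bullet> b' = 0"
      "\<forall>u\<in>W. (\<Sum>b\<in>B. (b \<bullet> u) *\<^sub>R b) = u"
      using less.hyps[OF _ W] by blast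
    have vB: "v \<bullet> b = 0" "b \<bullet> v = 0" if "b \<in> B" for b
      using that B(2) by (auto simp: W_def inner_commute)
    have "v \<notin> B" using B(2) \<open>v \<notin> W\<close> by blast
    have "(\<Sum>b\<in>insert v B. (b \<bullet> u) *\<^sub>R b) = u" if "u \<in> U" for u
    proof -
      \<comment> \<open>Without its component along \<open>v\<close>, the vector lies in
        \<open>W\<close>. Its coefficients with respect to \<open>B\<close> are unchanged, since
        \<open>v\<close> is orthogonal to \<open>B\<close>.\<close>
      have "u - (v \<bullet> u) *\<^sub>R v \<in> W"
        using that v less.prems(1) vv
        by (simp add: W_def subspace_diff subspace_scale inner_diff_right)
      then have "(\<Sum>b\<in>B. (b \<bullet> (u - (v \<bullet> u) *\<^sub>R v)) *\<^sub>R b) = u - (v \<bullet> u) *\<^sub>R v"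
        using B(5) by blast
      moreover have "(\<Sum>b\<in>B. (b \<bullet> (u - (v \<bullet> u) *\<^sub>R v)) *\<^sub>R b) = (\<Sum>b\<in>B. (b \<bullet> u) *\<^sub>R b)"
        by (intro sum.cong) (auto simp: inner_diff_right vB)
      ultimately show ?thesis
        using B(1) \<open>v \<notin> B\<close> by simp
    qed
    moreover have "insert v B \<subseteq> U" using B(2) v by (auto simp: W_def)
    ultimately show ?thesis
      using B(1,3,4) v vB by (intro exI[of _ "insert v B"]) auto
  qed
qed

text \<open>The matrices that are diagonal in a fixed orthonormal basis \<open>B\<close> form a commutative algebra
  isomorphic to the functions on \<open>B\<close>.\<close>

locale orthonormal_basis =
  fixes B :: "(real^'n) set"
  assumes finite_basis: "finite B"
    and norm_basis: "b \<in> B \<Longrightarrow> norm b = 1"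
    and orthogonal_basis: "b \<in> B \<Longrightarrow> b' \<in> B \<Longrightarrow> b \<noteq> b' \<Longrightarrow> b \<bullet> b' = 0"
    and expand_basis: "(\<Sum>b\<in>B. (b \<bullet> v) *\<^sub>R b) = v"
begin

text \<open>A weighted sum of the rank-one orthogonal projections onto the lines spanned by the
  basis vectors; \<open>f b\<close> is the eigenvalue at \<open>b\<close>.\<close>

definition spectral :: "(real^'n \<Rightarrow> real) \<Rightarrow> real^'n^'n" where
  "spectral f = (\<Sum>b\<in>B. f b *\<^sub>R (\<chi> i j. b $ i * b $ j))"

lemma inner_basis: "b \<in> B \<Longrightarrow> b' \<in> B \<Longrightarrow> b \<bullet> b' = (if b = b' then 1 else 0)"
  using norm_basis orthogonal_basis by (auto simp: norm_eq_1)

lemma spectral_cong: "(\<And>b. b \<in> B \<Longrightarrow> f b = g b) \<Longrightarrow> spectral f = spectral g"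
  by (simp add: spectral_def)

lemma spectral_mult_vec: "spectral f *v v = (\<Sum>b\<in>B. (f b * (b \<bullet> v)) *\<^sub>R b)"
proof -
  have "spectral f *v v = (\<Sum>b\<in>B. (f b *\<^sub>R (\<chi> i j. b $ i * b $ j)) *v v)"
    unfolding spectral_def using finite_basis
    by (induction rule: finite_induct) (auto simp: matrix_vector_mult_add_rdistrib)
  also have "\<dots> = (\<Sum>b\<in>B. (f b * (b \<bullet> v)) *\<^sub>R b)"
    by (intro sum.cong refl)
      (simp add: vec_eq_iff matrix_vector_mult_def inner_vec_def sum_distrib_left sum_distrib_right mult_ac)
  finally show ?thesis .
qed

lemma spectral_mult_basis: "b \<in> B \<Longrightarrow> spectral f *v b = f b *\<^sub>R b"
proof -
  assume b: "b \<in> B"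
  have "spectral f *v b = (\<Sum>b'\<in>B. if b' = b then f b *\<^sub>R b else 0)"
    unfolding spectral_mult_vec using b by (intro sum.cong) (auto simp: inner_basis)
  then show ?thesis using b finite_basis by simp
qed

lemma eq_spectralI:
  assumes "\<And>b. b \<in> B \<Longrightarrow> X *v b = f b *\<^sub>R b"
  shows "X = spectral f"
proof (subst matrix_eq, intro allI)
  fix v
  have "X *v v = X *v (\<Sum>b\<in>B. (b \<bullet> v) *\<^sub>R b)"
    by (simp add: expand_basis)
  also have "\<dots> = (\<Sum>b\<in>B. (b \<bullet> v) *\<^sub>R (X *v b))"
    using finite_basis
    by (induction rule: finite_induct)
      (auto simp: matrix_vector_right_distrib matrix_vector_mult_scaleR)
  also have "\<dots> = spectral f *v v"
    unfolding spectral_mult_vec by (intro sum.cong) (auto simp: assms mult.commute)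
  finally show "X *v v = spectral f *v v" .
qed

lemma spectral_eq_iff: "spectral f = spectral g \<longleftrightarrow> (\<forall>b\<in>B. f b = g b)"
proof
  assume "spectral f = spectral g"
  then have "f b *\<^sub>R b = g b *\<^sub>R b" if "b \<in> B" for b
    using that by (metis spectral_mult_basis)
  moreover have "b \<noteq> 0" if "b \<in> B" for b
    using norm_basis[OF that] by auto
  ultimately show "\<forall>b\<in>B. f b = g b" by simp
qed (auto intro: spectral_cong)

lemma spectral_0: "spectral (\<lambda>_. 0) = 0"
  by (simp add: spectral_def)

lemma spectral_1: "spectral (\<lambda>_. 1) = mat 1"
  by (rule sym, rule eq_spectralI) simp

lemma spectral_add: "spectral f + spectral g = spectral (\<lambda>b. f b + g b)"
  by (simp add: spectral_def scaleR_add_left sum.distrib)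

lemma spectral_minus: "- spectral f = spectral (\<lambda>b. - f b)"
  by (simp add: spectral_def sum_negf)

lemma spectral_diff: "spectral f - spectral g = spectral (\<lambda>b. f b - g b)"
  by (simp add: spectral_def scaleR_diff_left sum_subtractf)

lemma spectral_scaleR: "c *\<^sub>R spectral f = spectral (\<lambda>b. c * f b)"
  by (simp add: spectral_def scaleR_sum_right)

lemma spectral_mult: "spectral f ** spectral g = spectral (\<lambda>b. f b * g b)"
  by (rule eq_spectralI)
    (simp add: spectral_mult_basis matrix_vector_mult_scaleR mult.commute flip: matrix_vector_mul_assoc)

lemma spectral_mat_pow: "mat_pow (spectral f) n = spectral (\<lambda>b. f b ^ n)"
  by (induction n) (simp_all add: spectral_mult spectral_1)

lemma spectral_inverse:
  assumes "\<And>b. b \<in> B \<Longrightarrow> f b \<noteq> 0"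
  shows "spectral f ** spectral (\<lambda>b. 1 / f b) = mat 1"
  unfolding spectral_mult spectral_1[symmetric] using assms by (intro spectral_cong) auto

lemma invertible_spectral_iff: "invertible (spectral f) \<longleftrightarrow> (\<forall>b\<in>B. f b \<noteq> 0)"
proof
  assume inv: "invertible (spectral f)"
  show "\<forall>b\<in>B. f b \<noteq> 0"
  proof
    fix b assume b: "b \<in> B"
    obtain Y where Y: "Y ** spectral f = mat 1"
      using inv by (auto simp: invertible_def)
    have "b = Y *v (spectral f *v b)"
      by (simp add: matrix_vector_mul_assoc Y)
    also have "\<dots> = f b *\<^sub>R (Y *v b)"
      using b by (simp add: spectral_mult_basis matrix_vector_mult_scaleR)
    finally show "f b \<noteq> 0"
      using norm_basis[OF b] by auto
  qed
qed (meson invertible_right_inverse spectral_inverse)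

lemma matrix_inv_spectral:
  assumes "\<And>b. b \<in> B \<Longrightarrow> f b \<noteq> 0"
  shows "matrix_inv (spectral f) = spectral (\<lambda>b. 1 / f b)"
proof -
  have "invertible (spectral f)"
    using assms by (simp add: invertible_spectral_iff)
  \<comment> \<open>\<open>matrix_inv\<close> is defined by choice; it is identified with the
    explicit inverse by uniqueness of inverses.\<close>
  then have "matrix_inv (spectral f) ** spectral f = mat 1"
    unfolding invertible_def matrix_inv_def by (rule someI2_ex) blast
  then show ?thesis
    using spectral_inverse[of f] assms
    by (metis matrix_mul_assoc matrix_mul_lid matrix_mul_rid)
qed

lemma mfrac_spectral:
  "(\<And>b. b \<in> B \<Longrightarrow> g b \<noteq> 0) \<Longrightarrow> mfrac (spectral f) (spectral g) = spectral (\<lambda>b. f b / g b)"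
  by (simp add: mfrac_def matrix_inv_spectral spectral_mult)

lemma tendsto_spectral:
  "(\<And>b. b \<in> B \<Longrightarrow> (\<lambda>n. f n b) \<longlonglongrightarrow> g b) \<Longrightarrow> (\<lambda>n. spectral (f n)) \<longlonglongrightarrow> spectral g"
  unfolding spectral_def by (intro tendsto_sum tendsto_scaleR tendsto_const)

lemma sum_spectral: "(\<Sum>k<n. spectral (f k)) = spectral (\<lambda>b. \<Sum>k<n. f k b)" for n :: nat
  by (induction n) (simp_all add: spectral_0 spectral_add)

lemma suminf_spectral:
  assumes "\<And>b. b \<in> B \<Longrightarrow> (\<lambda>n. f n b) sums g b"
  shows "(\<Sum>n. spectral (f n)) = spectral g"
  using assms unfolding sums_def
  by (intro sums_unique[symmetric]) (simp add: sums_def sum_spectral tendsto_spectral)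

lemma mat_exp_spectral: "mat_exp (spectral f) = spectral (\<lambda>b. exp (f b))"
  unfolding mat_exp_def spectral_mat_pow spectral_scaleR
proof (rule suminf_spectral)
  fix b
  show "(\<lambda>n. 1 / fact n * f b ^ n) sums exp (f b)"
    using exp_converges[of "f b"] by (simp add: field_simps)
qed

text \<open>On eigenvalues, \<open>phi\<close> is y |-> (1 - y) / (1 + y). The series of
  \<open>mat_ln\<close> is the expansion of ln y in odd powers of (y - 1) / (y + 1); the sign change
  of the base passes through the odd powers and is compensated by the factor
  \<open>-2\<close>.\<close>

lemma positive_spectral_ln:
  assumes A: "A = spectral f" and pos: "\<And>b. b \<in> B \<Longrightarrow> 0 < f b"
  shows "phi A = spectral (\<lambda>b. (1 - f b) / (1 + f b))"
    and "mat_ln A = spectral (\<lambda>b. ln (f b))"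
    and "mat_powr A q = spectral (\<lambda>b. exp (q * ln (f b)))"
proof -
  show phi: "phi A = spectral (\<lambda>b. (1 - f b) / (1 + f b))"
    unfolding phi_def A spectral_1[symmetric] spectral_add spectral_diff
    by (intro mfrac_spectral) (metis add_pos_pos less_irrefl pos zero_less_one)
  have "(\<Sum>n. (1 / (2 * real n + 1)) *\<^sub>R mat_pow (phi A) (2 * n + 1)) = spectral (\<lambda>b. - ln (f b) / 2)"
    unfolding phi spectral_mat_pow spectral_scaleR
  proof (rule suminf_spectral)
    fix b assume "b \<in> B"
    then have "(\<lambda>n. 2 * ((f b - 1) / (f b + 1)) ^ (2 * n + 1) / real (2 * n + 1)) sums ln (f b)"
      using pos ln_series_quadratic by blast
    from sums_mult[OF this, of "- 1 / 2"]
    have "(\<lambda>n. - (((f b - 1) / (f b + 1)) ^ (2 * n + 1) / real (2 * n + 1))) sums (- ln (f b) / 2)"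
      by simp
    moreover have "- (((f b - 1) / (f b + 1)) ^ (2 * n + 1) / real (2 * n + 1))
        = 1 / (2 * real n + 1) * ((1 - f b) / (1 + f b)) ^ (2 * n + 1)" for n
    proof -
      have "(1 - f b) / (1 + f b) = - ((f b - 1) / (f b + 1))"
        unfolding minus_divide_left by (simp add: add.commute)
      then show ?thesis
        by (simp only: power_minus_odd[of "2 * n + 1"]) simp
    qed
    ultimately show "(\<lambda>n. 1 / (2 * real n + 1) * ((1 - f b) / (1 + f b)) ^ (2 * n + 1)) sums (- ln (f b) / 2)"
      by simp
  qed
  then show ln: "mat_ln A = spectral (\<lambda>b. ln (f b))"
    unfolding mat_ln_def by (simp add: spectral_scaleR)
  show "mat_powr A q = spectral (\<lambda>b. exp (q * ln (f b)))"
    unfolding mat_powr_def ln spectral_scaleR by (rule mat_exp_spectral)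
qed

end

lemma positive_definite_spectral:
  fixes A :: "real^'n^'n"
  assumes "positive_definite A"
  obtains B f where "orthonormal_basis B" "A = orthonormal_basis.spectral B f" "\<And>b. b \<in> B \<Longrightarrow> 0 < f b"
proof -
  obtain B where B: "finite B" "\<forall>b\<in>B. norm b = 1 \<and> (\<exists>c. A *v b = c *\<^sub>R b)"
      "\<forall>b\<in>B. \<forall>b'\<in>B. b \<noteq> b' \<longrightarrow> b \<bullet> b' = 0" "\<forall>u. (\<Sum>b\<in>B. (b \<bullet> u) *\<^sub>R b) = u"
    using symmetric_eigenbasis_subspace[of A UNIV] assms by (auto simp: positive_definite_def)
  then interpret orthonormal_basis B
    by unfold_locales auto
  \<comment> \<open>The eigenvalue is written as a Rayleigh quotient, which makes its positivity the
    definition of positive definiteness.\<close>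
  define f where "f b = b \<bullet> (A *v b)" for b
  have "A *v b = f b *\<^sub>R b" if "b \<in> B" for b
    using B(2) that by (auto simp: f_def norm_eq_1)
  then have "A = spectral f" by (rule eq_spectralI)
  moreover have "0 < f b" if "b \<in> B" for b
  proof -
    have "b \<noteq> 0" using norm_basis[OF that] by auto
    then show ?thesis using assms by (simp add: f_def positive_definite_def)
  qed
  ultimately show ?thesis
    using that orthonormal_basis_axioms by blast
qed


section \<open>The product of two continued fractions\<close>

text \<open>Scalar counterparts of \<open>cf_num\<close> and \<open>cf_den\<close>, to be applied to
  each eigenvalue separately.\<close>

fun cnum :: "(nat \<Rightarrow> real) \<Rightarrow> (nat \<Rightarrow> real) \<Rightarrow> nat \<Rightarrow> real" where
  "cnum a b 0 = a 0"
| "cnum a b (Suc 0) = a 1 * a 0 + b 1"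
| "cnum a b (Suc (Suc n)) = a (Suc (Suc n)) * cnum a b (Suc n) + b (Suc (Suc n)) * cnum a b n"

fun cden :: "(nat \<Rightarrow> real) \<Rightarrow> (nat \<Rightarrow> real) \<Rightarrow> nat \<Rightarrow> real" where
  "cden a b 0 = 1"
| "cden a b (Suc 0) = a 1"
| "cden a b (Suc (Suc n)) = a (Suc (Suc n)) * cden a b (Suc n) + b (Suc (Suc n)) * cden a b n"

text \<open>With unit partial numerators each step only reverses the sign of the
  determinant.\<close>

lemma continuant_determinant:
  "cnum a (\<lambda>_. 1) (Suc n) * cden a (\<lambda>_. 1) n
     = cnum a (\<lambda>_. 1) n * cden a (\<lambda>_. 1) (Suc n) + (- 1) ^ n"
  by (induction n) (simp_all add: algebra_simps)

context
  fixes a c :: "nat \<Rightarrow> real"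
begin

private abbreviation "P \<equiv> cnum a (\<lambda>_. 1)"
private abbreviation "Q \<equiv> cden a (\<lambda>_. 1)"
private abbreviation "P' \<equiv> cnum c (\<lambda>_. 1)"
private abbreviation "Q' \<equiv> cden c (\<lambda>_. 1)"

definition scalar_E :: "nat \<Rightarrow> real" where
  "scalar_E n = Q n * Q' n * (Q (n - 2) * P (n - 1) + Q' (n - 1) * P' (n - 2))"

definition scalar_F :: "nat \<Rightarrow> real" where
  "scalar_F n = Q (n - 2) * Q' (n - 2) * (Q n * P (n - 1) + Q' (n - 1) * P' n)"

definition scalar_prod_num :: "nat \<Rightarrow> real" where
  "scalar_prod_num n =
    (if n = 0 then 0
     else if n = 1 then a 1 + 1
     else if n = 2 then (a 1 * a 2 + 1) * (a 1 + 1) + c 1 * c 2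
     else if n = 3 then 1 / (a 1 * c 1) * scalar_E 2 * scalar_F 3
     else scalar_E (n - 1) * scalar_F n)"

definition scalar_prod_den :: "nat \<Rightarrow> real" where
  "scalar_prod_den n =
    (if n = 0 then 0
     else if n = 1 then a 1 * c 1
     else if n = 2 then (a 1 * a 2 + a 2 + 1) * c 2
     else scalar_E n - scalar_F n)"

text \<open>This is the quantity \<open>g (n + 1)\<close>; the shift avoids predecessors of
  indices.\<close>

definition prod_gap :: "nat \<Rightarrow> real" where
  "prod_gap n = P n * Q (Suc n) + P' (Suc n) * Q' n"

text \<open>The product of the convergents is a fraction whose numerator and denominator are both to be
  multiplied by \<open>prod_scale n\<close> in order to obtain those of the product continued fraction.\<close>

fun prod_scale :: "nat \<Rightarrow> real" where
  "prod_scale 0 = 1"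
| "prod_scale (Suc 0) = 1"
| "prod_scale (Suc (Suc 0)) = prod_gap 0"
| "prod_scale (Suc (Suc (Suc n))) = prod_gap (Suc n) * (Q (n + 2) * Q' (n + 2)) * prod_scale (n + 2)"

text \<open>The last factor of \<open>scalar_E\<close> becomes \<open>prod_gap n\<close> on applying
  the determinant formula to both fractions: the two signs are opposite and cancel.\<close>

lemma scalar_E_eq: "scalar_E (Suc (Suc n)) = Q (Suc (Suc n)) * Q' (Suc (Suc n)) * prod_gap n"
  using continuant_determinant[of a n] continuant_determinant[of c n]
  by (simp add: scalar_E_def prod_gap_def algebra_simps del: cnum.simps cden.simps)

lemma scalar_F_eq: "scalar_F (Suc (Suc n)) = Q n * Q' n * prod_gap (Suc n)"
  by (simp add: scalar_F_def prod_gap_def algebra_simps del: cnum.simps cden.simps)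

text \<open>The determinant formula is applied first to the factor from \<open>a\<close>, then, in
  the leading term only, to the factor from \<open>c\<close>. This asymmetry produces the mixed
  indices of \<open>prod_gap\<close>.\<close>

lemma product_determinant:
  "P (Suc n) * P' (Suc n) * (Q n * Q' n) - P n * P' n * (Q (Suc n) * Q' (Suc n)) = (- 1) ^ n * prod_gap n"
proof -
  have "P (Suc n) * P' (Suc n) * (Q n * Q' n) = (P (Suc n) * Q n) * (P' (Suc n) * Q' n)"
    by simp
  also have "\<dots> = P n * Q (Suc n) * (P' (Suc n) * Q' n) + (- 1) ^ n * (P' (Suc n) * Q' n)"
    by (simp only: continuant_determinant distrib_right)
  also have "P n * Q (Suc n) * (P' (Suc n) * Q' n)
      = P n * Q (Suc n) * (P' n * Q' (Suc n)) + (- 1) ^ n * (P n * Q (Suc n))"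
    using continuant_determinant[of c n] by (simp add: algebra_simps del: cnum.simps cden.simps)
  finally show ?thesis
    by (simp add: prod_gap_def algebra_simps del: cnum.simps cden.simps)
qed

text \<open>The common three-term recurrence of the products of numerators and of denominators,
  before rescaling. Its coefficients are the determinants of pairs of neighbouring or next-but-one
  terms, as in Cramer's rule.\<close>

lemma product_step:
  fixes n :: nat
  defines "p \<equiv> \<lambda>k. P k * P' k" and "q \<equiv> \<lambda>k. Q k * Q' k"
  assumes x: "x = p \<or> x = q"
  shows "(scalar_E (n + 3) - scalar_F (n + 3)) * x (n + 2) + q (n + 2) * prod_gap (n + 2) * x (n + 1)
      = prod_gap (n + 1) * q (n + 2) * x (n + 3)"
proof -
  have 1: "p (n + 2) * q (n + 1) - p (n + 1) * q (n + 2) = (- 1) ^ (n + 1) * prod_gap (n + 1)"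
    and 2: "p (n + 3) * q (n + 2) - p (n + 2) * q (n + 3) = - ((- 1) ^ (n + 1) * prod_gap (n + 2))"
    using product_determinant[of "n + 1"] product_determinant[of "n + 2"]
    by (simp_all add: p_def q_def numeral_3_eq_3 del: cnum.simps cden.simps)
  have E: "scalar_E (n + 3) = q (n + 3) * prod_gap (n + 1)" and F: "scalar_F (n + 3) = q (n + 1) * prod_gap (n + 2)"
    using scalar_E_eq[of "n + 1"] scalar_F_eq[of "n + 1"]
    by (simp_all add: q_def numeral_3_eq_3 del: cnum.simps cden.simps)
  from x show ?thesis
  proof
    assume "x = p"
    \<comment> \<open>Regrouped as a combination of two consecutive determinants, which have
      opposite signs by \<open>1\<close> and \<open>2\<close>.\<close>
    have "(q (n + 3) * prod_gap (n + 1) - q (n + 1) * prod_gap (n + 2)) * p (n + 2) + q (n + 2) * prod_gap (n + 2) * p (n + 1)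
        - prod_gap (n + 1) * q (n + 2) * p (n + 3)
      = - prod_gap (n + 2) * (p (n + 2) * q (n + 1) - p (n + 1) * q (n + 2))
        - prod_gap (n + 1) * (p (n + 3) * q (n + 2) - p (n + 2) * q (n + 3))"
      by (simp only: algebra_simps)
    also have "\<dots> = 0"
      unfolding 1 2 by simp
    finally show ?thesis
      unfolding E F \<open>x = p\<close> by simp
  qed (simp add: E F algebra_simps)
qed

text \<open>Rescaling \<open>product_step\<close> by \<open>prod_scale\<close> gives the recurrence
  of the product fraction. The irregular partial quotients at the indices 1 to 3 bring the scale
  from 1 to its general pattern.\<close>

lemma product_continuants:
  assumes "a 0 = 1" "c 0 = 0" and nz: "a 1 \<noteq> 0" "c 1 \<noteq> 0"
  shows "cnum scalar_prod_den scalar_prod_num n = prod_scale n * (P n * P' n)"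
    and "cden scalar_prod_den scalar_prod_num n = prod_scale n * (Q n * Q' n)"
proof -
  define p q where "p k = P k * P' k" and "q k = Q k * Q' k" for k
  \<comment> \<open>One induction serves numerators (\<open>x = p\<close>) and denominators
    (\<open>x = q\<close>).\<close>
  have main: "X n = prod_scale n * x n"
    if x: "x = p \<or> x = q"
      and X: "\<And>k. X (k + 2) = scalar_prod_den (k + 2) * X (k + 1) + scalar_prod_num (k + 2) * X k"
      and X012: "X 0 = x 0" "X 1 = x 1" "X 2 = prod_gap 0 * x 2"
    for X x :: "nat \<Rightarrow> real" and n
  proof (induction n rule: less_induct)
    case (less n)
    have step: "(scalar_E (k + 3) - scalar_F (k + 3)) * x (k + 2) + q (k + 2) * prod_gap (k + 2) * x (k + 1)
      = prod_gap (k + 1) * q (k + 2) * x (k + 3)" for k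
      using product_step[of x k] x unfolding p_def q_def by (auto simp: fun_eq_iff)
    consider "n = 0" | "n = 1" | "n = 2" | "n = 3" | "n \<ge> 4"
      by linarith
    then show ?case
    proof cases
      case 4
      have "X 3 = (scalar_E 3 - scalar_F 3) * X 2 + 1 / (a 1 * c 1) * scalar_E 2 * scalar_F 3 * X 1"
        using X[of 1] by (simp add: scalar_prod_num_def scalar_prod_den_def numeral_2_eq_2 numeral_3_eq_3)
      \<comment> \<open>The prefactor cancels \<open>Q 1 * Q' 1\<close>, which is the factor of
        \<open>scalar_F 3\<close> not matched by the scale.\<close>
      also have "1 / (a 1 * c 1) * scalar_E 2 * scalar_F 3 = q 2 * prod_gap 0 * prod_gap 2"
        using scalar_E_eq[of 0] scalar_F_eq[of 1] nz
        by (simp add: q_def numeral_2_eq_2 numeral_3_eq_3 del: cden.simps(3))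
      also have "(scalar_E 3 - scalar_F 3) * X 2 + q 2 * prod_gap 0 * prod_gap 2 * X 1
          = prod_gap 0 * ((scalar_E 3 - scalar_F 3) * x 2 + q 2 * prod_gap 2 * x 1)"
        unfolding X012 by (simp only: algebra_simps)
      also have "\<dots> = prod_gap 0 * (prod_gap 1 * q 2 * x 3)"
        using step[of 0] by (simp only: add_0)
      also have "\<dots> = prod_scale 3 * x 3"
        by (simp add: q_def numeral_2_eq_2 numeral_3_eq_3 del: cden.simps)
      finally show ?thesis using 4 by simp
    next
      case n: 5
      obtain k where 5: "n = k + 4"
        using n by (metis add.commute le_Suc_ex)
      have "X (k + 4) = (scalar_E (k + 4) - scalar_F (k + 4)) * X (k + 3) + scalar_E (k + 3) * scalar_F (k + 4) * X (k + 2)"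
        using X[of "k + 2"] by (simp add: scalar_prod_num_def scalar_prod_den_def eval_nat_numeral)
      also have "X (k + 3) = prod_gap (k + 1) * q (k + 2) * prod_scale (k + 2) * x (k + 3)"
        using less[of "k + 3"] 5 by (simp add: q_def eval_nat_numeral)
      also have "X (k + 2) = prod_scale (k + 2) * x (k + 2)"
        using less 5 by simp
      also have "scalar_E (k + 3) = q (k + 3) * prod_gap (k + 1)"
        using scalar_E_eq[of "k + 1"] by (simp add: q_def eval_nat_numeral del: cden.simps)
      also have "scalar_F (k + 4) = q (k + 2) * prod_gap (k + 3)"
        using scalar_F_eq[of "k + 2"] by (simp add: q_def eval_nat_numeral del: cden.simps)
      \<comment> \<open>The partial numerator contains \<open>prod_gap (k + 1) * q (k + 2)\<close>,
        exactly the ratio of the scales at \<open>k + 3\<close> and \<open>k + 2\<close>, so it can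
        be factored out.\<close>
      finally have "X (k + 4) = prod_gap (k + 1) * q (k + 2) * prod_scale (k + 2) *
          ((scalar_E (k + 4) - q (k + 2) * prod_gap (k + 3)) * x (k + 3) + q (k + 3) * prod_gap (k + 3) * x (k + 2))"
        by (simp add: algebra_simps)
      also have "q (k + 2) * prod_gap (k + 3) = scalar_F (k + 4)"
        using scalar_F_eq[of "k + 2"] by (simp add: q_def eval_nat_numeral del: cden.simps)
      also have "(scalar_E (k + 4) - scalar_F (k + 4)) * x (k + 3) + q (k + 3) * prod_gap (k + 3) * x (k + 2)
          = prod_gap (k + 2) * q (k + 3) * x (k + 4)"
        using step[of "k + 1"] by (simp add: eval_nat_numeral)
      finally show ?thesis
        using 5 by (simp add: q_def eval_nat_numeral del: cden.simps)
    qed (use X012 in \<open>simp_all add: numeral_2_eq_2\<close>)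
  qed
  show "cnum scalar_prod_den scalar_prod_num n = prod_scale n * (P n * P' n)"
    using main[of p "cnum scalar_prod_den scalar_prod_num" n] assms
    by (simp add: p_def scalar_prod_num_def scalar_prod_den_def prod_gap_def numeral_2_eq_2 algebra_simps)
  show "cden scalar_prod_den scalar_prod_num n = prod_scale n * (Q n * Q' n)"
    using main[of q "cden scalar_prod_den scalar_prod_num" n] assms
    by (simp add: q_def scalar_prod_num_def scalar_prod_den_def prod_gap_def numeral_2_eq_2 algebra_simps)
qed

end

section \<open>Transfer of continued fractions from eigenvalues to matrices\<close>

lemma tendsto_matrix_mult:
  fixes X :: "'a \<Rightarrow> real^'m^'n" and Y :: "'a \<Rightarrow> real^'k^'m"
  assumes "(X \<longlongrightarrow> K) F" "(Y \<longlongrightarrow> L) F"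
  shows "((\<lambda>i. X i ** Y i) \<longlongrightarrow> K ** L) F"
  unfolding matrix_matrix_mult_def 
  by (intro tendsto_vec_lambda tendsto_sum tendsto_mult tendsto_vec_nth assms)

context orthonormal_basis
begin

lemma cf_num_spectral:
  "cf_num (\<lambda>n. spectral (a n)) (\<lambda>n. spectral (b n)) n
    = spectral (\<lambda>v. cnum (\<lambda>n. a n v) (\<lambda>n. b n v) n)"
  by (induction n rule: induct_nat_012) (simp_all add: spectral_mult spectral_add)

lemma cf_den_spectral:
  "cf_den (\<lambda>n. spectral (a n)) (\<lambda>n. spectral (b n)) n
    = spectral (\<lambda>v. cden (\<lambda>n. a n v) (\<lambda>n. b n v) n)"
  by (induction n rule: induct_nat_012) (simp_all add: spectral_mult spectral_add spectral_1)

lemma cf_defined_spectral_iff: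
  "cf_defined (\<lambda>n. spectral (a n)) (\<lambda>n. spectral (b n))
    \<longleftrightarrow> (\<forall>v\<in>B. \<forall>n. cden (\<lambda>n. a n v) (\<lambda>n. b n v) n \<noteq> 0)"
  by (auto simp: cf_defined_def cf_den_spectral invertible_spectral_iff)

lemma cf_equals_spectral:
  assumes "\<And>v n. v \<in> B \<Longrightarrow> cden (\<lambda>n. a n v) (\<lambda>n. b n v) n \<noteq> 0"
    and "\<And>v. v \<in> B \<Longrightarrow> (\<lambda>n. cnum (\<lambda>n. a n v) (\<lambda>n. b n v) n / cden (\<lambda>n. a n v) (\<lambda>n. b n v) n) \<longlonglongrightarrow> g v"
  shows "cf_equals (\<lambda>n. spectral (a n)) (\<lambda>n. spectral (b n)) (spectral g)"
proof -
  have "(\<lambda>n. mfrac (cf_num (\<lambda>n. spectral (a n)) (\<lambda>n. spectral (b n)) n)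
      (cf_den (\<lambda>n. spectral (a n)) (\<lambda>n. spectral (b n)) n)) \<longlonglongrightarrow> spectral g"
    unfolding cf_num_spectral cf_den_spectral
    using assms by (simp add: mfrac_spectral tendsto_spectral)
  then show ?thesis
    using assms(1) unfolding cf_equals_def cf_defined_spectral_iff
    by (auto simp: tendsto_norm_zero_iff LIM_zero_iff)
qed

text \<open>All coefficients are diagonal in \<open>B\<close>, so the convergents of the product
  fraction are, eigenvalue by eigenvalue, the products of the convergents; then the limits
  multiply.\<close>

lemma cf_equals_product:
  assumes a: "\<And>n. a n \<in> range spectral" "a 0 = mat 1"
    and c: "\<And>n. c n \<in> range spectral" "c 0 = 0"
    and X: "cf_equals a ones X" and Y: "cf_equals c ones Y"
    and "cf_defined (prod_den a c) (prod_num a c)"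
  shows "cf_equals (prod_den a c) (prod_num a c) (X ** Y)"
proof -
  obtain f where f: "a = (\<lambda>n. spectral (f n))"
  proof -
    have "\<forall>n. \<exists>f. a n = spectral f" using a(1) by blast
    then show ?thesis using that by (auto simp: choice_iff fun_eq_iff)
  qed
  obtain g where g: "c = (\<lambda>n. spectral (g n))"
  proof -
    have "\<forall>n. \<exists>f. c n = spectral f" using c(1) by blast
    then show ?thesis using that by (auto simp: choice_iff fun_eq_iff)
  qed
  define F where "F v n = f n v" for v n
  define H where "H v n = g n v" for v n
  have f0: "F v 0 = 1" if "v \<in> B" for v
    using a(2) that by (simp add: f F_def spectral_eq_iff flip: spectral_1)
  have g0: "H v 0 = 0" if "v \<in> B" for v
    using c(2) that by (simp add: g H_def spectral_eq_iff flip: spectral_0)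
  let ?one = "\<lambda>_::nat. 1 :: real"
  have ones: "ones = (\<lambda>n. spectral (\<lambda>_. 1))"
    by (simp add: spectral_1)
  have num: "cf_num a ones n = spectral (\<lambda>v. cnum (F v) ?one n)"
      "cf_den a ones n = spectral (\<lambda>v. cden (F v) ?one n)"
      "cf_num c ones n = spectral (\<lambda>v. cnum (H v) ?one n)"
      "cf_den c ones n = spectral (\<lambda>v. cden (H v) ?one n)" for n
    unfolding f g ones cf_num_spectral cf_den_spectral F_def H_def by (rule refl)+
  have Q: "cden (F v) ?one n \<noteq> 0" "cden (H v) ?one n \<noteq> 0" if "v \<in> B" for v n
    using X Y that unfolding cf_equals_def f g ones cf_defined_spectral_iff F_def H_def by auto
  have nz: "F v 1 \<noteq> 0" "H v 1 \<noteq> 0" if "v \<in> B" for v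
    using Q[OF that, of 1] by auto
  have E: "E_term a c n = spectral (\<lambda>v. scalar_E (F v) (H v) n)"
    and F: "F_term a c n = spectral (\<lambda>v. scalar_F (F v) (H v) n)" for n
    by (simp_all add: E_term_def F_term_def num spectral_mult spectral_add scalar_E_def scalar_F_def)
  have ac: "a n = spectral (\<lambda>v. F v n)" "c n = spectral (\<lambda>v. H v n)" for n
    by (simp_all add: f g F_def H_def)
  have inv: "matrix_inv (spectral (\<lambda>v. F v 1 * H v 1)) = spectral (\<lambda>v. 1 / (F v 1 * H v 1))"
    using nz by (intro matrix_inv_spectral) auto
  have pd: "prod_den a c = (\<lambda>n. spectral (\<lambda>v. scalar_prod_den (F v) (H v) n))"
    by (rule ext) (simp add: prod_den_def scalar_prod_den_def E F ac spectral_mult spectral_add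
        spectral_diff flip: spectral_1 spectral_0)
  have pn: "prod_num a c = (\<lambda>n. spectral (\<lambda>v. scalar_prod_num (F v) (H v) n))"
    by (rule ext) (simp add: prod_num_def scalar_prod_num_def inv[simplified] E F ac spectral_mult spectral_add
        flip: spectral_1 spectral_0)
  have cden: "cden (scalar_prod_den (F v) (H v)) (scalar_prod_num (F v) (H v)) n \<noteq> 0" if "v \<in> B" for v n
    using assms(7) that unfolding pd pn cf_defined_spectral_iff by blast
  have "(\<lambda>n. mfrac (cf_num a ones n) (cf_den a ones n) ** mfrac (cf_num c ones n) (cf_den c ones n))
      \<longlonglongrightarrow> X ** Y"
    using X Y unfolding cf_equals_def
    by (intro tendsto_matrix_mult) (simp_all add: tendsto_norm_zero_iff LIM_zero_iff)
  also have "(\<lambda>n. mfrac (cf_num a ones n) (cf_den a ones n) ** mfrac (cf_num c ones n) (cf_den c ones n))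
      = (\<lambda>n. mfrac (cf_num (prod_den a c) (prod_num a c) n) (cf_den (prod_den a c) (prod_num a c) n))"
  proof
    fix n
    have "mfrac (cf_num a ones n) (cf_den a ones n) ** mfrac (cf_num c ones n) (cf_den c ones n)
        = spectral (\<lambda>v. cnum (F v) ?one n / cden (F v) ?one n * (cnum (H v) ?one n / cden (H v) ?one n))"
      unfolding num using Q by (simp add: mfrac_spectral spectral_mult)
    also have "\<dots> = spectral (\<lambda>v. cnum (scalar_prod_den (F v) (H v)) (scalar_prod_num (F v) (H v)) n
        / cden (scalar_prod_den (F v) (H v)) (scalar_prod_num (F v) (H v)) n)"
    proof (rule spectral_cong)
      fix v assume v: "v \<in> B"
      note eq = product_continuants[OF f0[OF v] g0[OF v] nz[OF v], of n]
      \<comment> \<open>The denominator of the product fraction contains the scale as a factor, so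
        definedness of that fraction allows it to be cancelled.\<close>
      have "prod_scale (F v) (H v) n \<noteq> 0"
        using cden[OF v, of n] unfolding eq by auto
      then show "cnum (F v) ?one n / cden (F v) ?one n * (cnum (H v) ?one n / cden (H v) ?one n)
        = cnum (scalar_prod_den (F v) (H v)) (scalar_prod_num (F v) (H v)) n
          / cden (scalar_prod_den (F v) (H v)) (scalar_prod_num (F v) (H v)) n"
        unfolding eq by simp
    qed
    also have "\<dots> = mfrac (cf_num (prod_den a c) (prod_num a c) n) (cf_den (prod_den a c) (prod_num a c) n)"
      unfolding pd pn cf_num_spectral cf_den_spectral using cden by (simp add: mfrac_spectral)
    finally show "mfrac (cf_num a ones n) (cf_den a ones n) ** mfrac (cf_num c ones n) (cf_den c ones n)
      = mfrac (cf_num (prod_den a c) (prod_num a c) n) (cf_den (prod_den a c) (prod_num a c) n)" .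
  qed
  finally show ?thesis
    using assms(7) unfolding cf_equals_def by (simp add: tendsto_norm_zero_iff LIM_zero_iff)
qed

end


section \<open>The expansions with unit partial numerators\<close>

lemma evens_nonzero:
  assumes "0 \<le> q" "q < 1"
  shows "evens q k \<noteq> 0"
proof -
  have "q\<^sup>2 < (2 * real j)\<^sup>2" if "1 \<le> j" for j
    using that assms by (intro power_strict_mono) auto
  then show ?thesis
    unfolding evens_def by (subst prod_zero_iff) force+
qed

lemma odds_nonzero:
  assumes "0 \<le> q" "q < 1"
  shows "odds q k \<noteq> 0"
proof -
  have "q\<^sup>2 < (2 * real j - 1)\<^sup>2" if "1 \<le> j" for j
    using that assms by (intro power_strict_mono) auto
  then show ?thesis
    unfolding odds_def by (subst prod_zero_iff) force+
qed

lemma evens_Suc: "evens q (Suc k) = evens q k * (q\<^sup>2 - (2 * real k + 2)\<^sup>2)"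
  by (simp add: evens_def power2_eq_square algebra_simps)

lemma odds_Suc: "odds q (Suc k) = odds q k * (q\<^sup>2 - (2 * real k + 1)\<^sup>2)"
  by (simp add: odds_def algebra_simps)

text \<open>The equivalence transformation from the fraction with partial numerators \<open>- 2 * w * x\<close> and
  \<open>(q^2 - n^2) * x^2\<close> to the one with unit partial numerators.\<close>

definition unit_scale :: "real \<Rightarrow> real \<Rightarrow> real \<Rightarrow> nat \<Rightarrow> real" where
  "unit_scale q w x n = (if even n then 1 / (odds q (n div 2) * x ^ n)
     else - 1 / (2 * w * evens q (n div 2) * x ^ n))"

text \<open>The convergents are \<open>z + w * (pade_num q x n / pade_den q x n)\<close>. The power
  has \<open>z = 1\<close> and \<open>w = q\<close>; the logarithm has \<open>z = 0\<close>,
  \<open>q = 0\<close> and \<open>w = 1\<close>, which is why \<open>w\<close> is separate from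
  \<open>q\<close>.\<close>

definition unit_coeff :: "real \<Rightarrow> real \<Rightarrow> real \<Rightarrow> real \<Rightarrow> nat \<Rightarrow> real" where
  "unit_coeff z q w x n = (if n = 0 then z else if n = 1 then - (1 + q * x) / (2 * w * x)
     else (2 * real n - 1) * (unit_scale q w x n / unit_scale q w x (n - 1)))"

context
  fixes q w x :: real
  assumes q: "0 \<le> q" "q < 1" and w: "w \<noteq> 0" and x: "x \<noteq> 0"
begin

lemma unit_scale_nonzero: "unit_scale q w x n \<noteq> 0"
  using evens_nonzero[OF q] odds_nonzero[OF q] w x by (simp add: unit_scale_def)

text \<open>The condition that the scaling turns the classical partial numerators into 1. The new
  factor involves n + 1, hence \<open>odds\<close> for even n and \<open>evens\<close> for odd
  n.\<close>

lemma unit_scale_step: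
  "unit_scale q w x (Suc (Suc n)) * (((real n + 1)\<^sup>2 - q\<^sup>2) * x\<^sup>2) = - unit_scale q w x n"
proof (cases "even n")
  case True
  then obtain k where n: "n = 2 * k" by blast
  define d where "d = q\<^sup>2 - (2 * real k + 1)\<^sup>2"
  have nz: "odds q k \<noteq> 0" "d \<noteq> 0"
    using odds_nonzero[OF q, of k] odds_nonzero[OF q, of "Suc k"] by (auto simp: odds_Suc d_def)
  have d: "(real n + 1)\<^sup>2 - q\<^sup>2 = - d"
    by (simp add: n d_def)
  have "unit_scale q w x (Suc (Suc n)) = 1 / (odds q k * d * (x * (x * x ^ n)))"
    by (simp add: unit_scale_def n odds_Suc d_def)
  then show ?thesis
    unfolding d using nz x by (simp add: unit_scale_def n power2_eq_square)
next
  case False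
  then obtain k where n: "n = 2 * k + 1" by (metis oddE)
  define d where "d = q\<^sup>2 - (2 * real k + 2)\<^sup>2"
  have nz: "evens q k \<noteq> 0" "d \<noteq> 0"
    using evens_nonzero[OF q, of k] evens_nonzero[OF q, of "Suc k"] by (auto simp: evens_Suc d_def)
  have d: "(real n + 1)\<^sup>2 - q\<^sup>2 = - d"
    by (simp add: n d_def algebra_simps)
  have "unit_scale q w x (Suc (Suc n)) = - 1 / (2 * w * (evens q k * d) * (x * (x * x ^ n)))"
    by (simp add: unit_scale_def n evens_Suc d_def)
  then show ?thesis
    unfolding d using nz w x by (simp add: unit_scale_def n power2_eq_square)
qed

text \<open>An equivalence transformation multiplies the continuants by the scale;
  \<open>unit_scale_step\<close> reconciles the two recurrences.\<close>

lemma unit_cden: "cden (unit_coeff z q w x) (\<lambda>_. 1) n = unit_scale q w x n * pade_den q x n"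
proof (induction n rule: induct_nat_012)
  case (ge2 n)
  have "cden (unit_coeff z q w x) (\<lambda>_. 1) (Suc (Suc n))
      = (2 * real n + 3) * unit_scale q w x (Suc (Suc n)) * pade_den q x (Suc n)
        + unit_scale q w x n * pade_den q x n"
    using unit_scale_nonzero by (simp add: ge2 unit_coeff_def)
  also have "unit_scale q w x n
      = - (unit_scale q w x (Suc (Suc n)) * (((real n + 1)\<^sup>2 - q\<^sup>2) * x\<^sup>2))"
    by (simp only: unit_scale_step minus_minus)
  finally show ?case
    by (simp add: algebra_simps)
qed (use w x in \<open>simp_all add: unit_coeff_def unit_scale_def odds_def evens_def field_simps\<close>)

lemma unit_cnum: "cnum (unit_coeff z q w x) (\<lambda>_. 1) n
    = unit_scale q w x n * (z * pade_den q x n + w * pade_num q x n)"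
proof (induction n rule: induct_nat_012)
  case 1
  have "z * (1 + q * x) + w * - 2 * x = - 2 * w * x * (- (1 + q * x) / (2 * w * x) * z + 1)"
    using w x by (simp add: field_simps)
  then show ?case
    using w x by (simp add: unit_coeff_def unit_scale_def evens_def field_simps)
next
  case (ge2 n)
  let ?y = "\<lambda>n. z * pade_den q x n + w * pade_num q x n"
  have "cnum (unit_coeff z q w x) (\<lambda>_. 1) (Suc (Suc n))
      = (2 * real n + 3) * unit_scale q w x (Suc (Suc n)) * ?y (Suc n) + unit_scale q w x n * ?y n"
    using unit_scale_nonzero by (simp add: ge2 unit_coeff_def)
  also have "unit_scale q w x n
      = - (unit_scale q w x (Suc (Suc n)) * (((real n + 1)\<^sup>2 - q\<^sup>2) * x\<^sup>2))"
    by (simp only: unit_scale_step minus_minus)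
  finally show ?case
    by (simp add: algebra_simps)
qed (simp add: unit_coeff_def unit_scale_def odds_def)

lemma unit_fraction:
  assumes "\<bar>x\<bar> < 1"
  shows "cden (unit_coeff z q w x) (\<lambda>_. 1) n \<noteq> 0"
    and "cnum (unit_coeff z q w x) (\<lambda>_. 1) n / cden (unit_coeff z q w x) (\<lambda>_. 1) n
      = z + w * (pade_num q x n / pade_den q x n)"
proof -
  have "pade_den q x n \<noteq> 0"
    using pade_den_pos[OF q assms] by (metis less_irrefl)
  then show "cden (unit_coeff z q w x) (\<lambda>_. 1) n \<noteq> 0"
    and "cnum (unit_coeff z q w x) (\<lambda>_. 1) n / cden (unit_coeff z q w x) (\<lambda>_. 1) n
      = z + w * (pade_num q x n / pade_den q x n)"
    using unit_scale_nonzero[of n] unfolding unit_cden unit_cnum by (auto simp: field_simps)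
qed

lemma unit_coeff_even:
  "unit_coeff z q w x (2 * Suc k) = - 2 * w * evens q k / odds q (Suc k) * (4 * real (Suc k) - 1) / x"
  using evens_nonzero[OF q, of k] odds_nonzero[OF q, of "Suc k"] w x
  by (simp add: unit_coeff_def unit_scale_def field_simps)

lemma unit_coeff_odd:
  "unit_coeff z q w x (Suc (2 * Suc k))
     = - odds q (Suc k) / (2 * w * evens q (Suc k)) * (4 * real (Suc k) + 1) / x"
  using evens_nonzero[OF q, of "Suc k"] odds_nonzero[OF q, of "Suc k"] w x
  by (simp add: unit_coeff_def unit_scale_def field_simps)

end

text \<open>For \<open>q = 0\<close> each factor is a negative square. In the coefficients of the
  logarithm the resulting signs differ at even indices, where \<open>odds\<close> has one factor
  more, and cancel at odd ones.\<close>

lemma evens_0: "evens 0 k = (- 1) ^ k * (\<Prod>j=1..k. 2 * real j)\<^sup>2"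
proof (induction k)
  case (Suc k)
  then show ?case by (simp add: evens_Suc power_mult_distrib add.commute)
qed (simp add: evens_def)

lemma odds_0: "odds 0 k = (- 1) ^ k * (\<Prod>j=1..k. 2 * real j - 1)\<^sup>2"
proof (induction k)
  case (Suc k)
  then show ?case by (simp add: odds_Suc power_mult_distrib add.commute)
qed (simp add: odds_def)

lemma nat_cases_parity:
  obtains "n = 0" | "n = 1" | k where "n = 2 * Suc k" | k where "n = 2 * Suc k + (1::nat)"
proof (cases n rule: parity_cases)
  case even
  then show ?thesis using that by (metis evenE mult_0_right not0_implies_Suc)
next
  case odd
  then show ?thesis using that by (metis oddE add_0 mult_0_right not0_implies_Suc)
qed

section \<open>The coefficient matrices as functions of the eigenvalues of
  \<open>phi A\<close>\<close>

context orthonormal_basis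
begin

lemma pow_den_spectral:
  assumes "0 < q" "q < 1" and phi: "phi A = spectral x" and x: "\<And>b. b \<in> B \<Longrightarrow> x b \<noteq> 0"
  shows "pow_den q A = (\<lambda>n. spectral (\<lambda>b. unit_coeff 1 q q (x b) n))"
proof
  fix n
  have mfrac: "mfrac (c *\<^sub>R mat 1) (phi A) = spectral (\<lambda>b. c / x b)" for c
    unfolding phi spectral_1[symmetric] spectral_scaleR using x by (subst mfrac_spectral) auto
  show "pow_den q A n = spectral (\<lambda>b. unit_coeff 1 q q (x b) n)"
  proof (cases n rule: nat_cases_parity)
    case 1
    then show ?thesis by (simp add: pow_den_def unit_coeff_def spectral_1)
  next
    case 2
    have "mfrac (- mat 1 - q *\<^sub>R phi A) ((2 * q) *\<^sub>R phi A)
        = spectral (\<lambda>b. (- 1 - q * x b) / (2 * q * x b))"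
      unfolding phi spectral_1[symmetric] spectral_scaleR spectral_minus spectral_diff
      using x assms by (intro mfrac_spectral) auto
    then show ?thesis
      using 2 by (simp add: pow_den_def unit_coeff_def)
  next
    case (3 k)
    have "pow_den q A n
        = mfrac ((- 2 * q * evens q k / odds q (Suc k) * (4 * real (Suc k) - 1)) *\<^sub>R mat 1) (phi A)"
    \<comment> \<open>The separately stated coefficient of index 2 fits the general even formula,
      with an empty product \<open>evens q 0\<close>.\<close>
    proof (cases k)
      case 0
      have "mfrac ((- 6 * q) *\<^sub>R mat 1) ((q\<^sup>2 - 1) *\<^sub>R phi A) = spectral (\<lambda>b. - 6 * q / ((q\<^sup>2 - 1) * x b))"
        unfolding phi spectral_1[symmetric] spectral_scaleR
        using x assms by (subst mfrac_spectral) (auto simp: power2_eq_1_iff)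
      then show ?thesis
        unfolding mfrac using 3 0 by (simp add: pow_den_def evens_def odds_def)
    qed (simp add: 3 pow_den_def)
    then show ?thesis
      unfolding mfrac using 3 x assms
      by (auto intro!: spectral_cong simp: unit_coeff_even simp del: mult_Suc_right)
  next
    case (4 k)
    have "pow_den q A n
        = mfrac ((- odds q (Suc k) / (2 * q * evens q (Suc k)) * (4 * real (Suc k) + 1)) *\<^sub>R mat 1) (phi A)"
      by (simp add: 4 pow_den_def)
    then show ?thesis
      unfolding mfrac using 4 x assms
      by (auto intro!: spectral_cong simp: unit_coeff_odd simp del: mult_Suc_right)
  qed
qed

lemma ln_den_spectral:
  assumes phi: "phi A = spectral x" and x: "\<And>b. b \<in> B \<Longrightarrow> x b \<noteq> 0"
  shows "ln_den A = (\<lambda>n. spectral (\<lambda>b. unit_coeff 0 0 1 (x b) n))"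
proof
  fix n
  have mfrac: "mfrac (c *\<^sub>R mat 1) (phi A) = spectral (\<lambda>b. c / x b)" for c
    unfolding phi spectral_1[symmetric] spectral_scaleR using x by (subst mfrac_spectral) auto
  show "ln_den A n = spectral (\<lambda>b. unit_coeff 0 0 1 (x b) n)"
  proof (cases n rule: nat_cases_parity)
    case 1
    then show ?thesis by (simp add: ln_den_def unit_coeff_def spectral_0)
  next
    case 2
    have "matrix_inv ((- 2) *\<^sub>R phi A) = spectral (\<lambda>b. 1 / (- 2 * x b))"
      unfolding phi spectral_scaleR using x by (intro matrix_inv_spectral) auto
    then show ?thesis
      using 2 by (simp add: ln_den_def unit_coeff_def)
  next
    case (3 k)
    have "ln_den A n
        = mfrac ((- 2 * 1 * evens 0 k / odds 0 (Suc k) * (4 * real (Suc k) - 1)) *\<^sub>R mat 1) (phi A)"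
    proof (cases k)
      case 0
      then show ?thesis
        using 3 by (simp add: ln_den_def evens_def odds_def)
    qed (simp add: 3 ln_den_def evens_0 odds_0)
    then show ?thesis
      unfolding mfrac using 3 x
      by (auto intro!: spectral_cong simp: unit_coeff_even simp del: mult_Suc_right)
  next
    case (4 k)
    have "ln_den A n
        = mfrac ((- odds 0 (Suc k) / (2 * 1 * evens 0 (Suc k)) * (4 * real (Suc k) + 1)) *\<^sub>R mat 1) (phi A)"
      by (simp add: 4 ln_den_def evens_0 odds_0)
    then show ?thesis
      unfolding mfrac using 4 x
      by (auto intro!: spectral_cong simp: unit_coeff_odd simp del: mult_Suc_right)
  qed
qed

text \<open>For the printed coefficients diagonality is enough, as the convergence of both factors
  is a premise of the corresponding half of the theorem.\<close>

lemma pow_den'_spectral: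
  assumes "0 < q" "q < 1" and phi: "phi A = spectral x" and x: "\<And>b. b \<in> B \<Longrightarrow> x b \<noteq> 0"
  shows "pow_den' q A n \<in> range spectral"
proof -
  have "mfrac (- mat 1 - q *\<^sub>R phi A) ((2 * q) *\<^sub>R phi A) \<in> range spectral"
    unfolding phi spectral_1[symmetric] spectral_scaleR spectral_minus spectral_diff
    using x assms by (subst mfrac_spectral) auto
  moreover have "mfrac ((- 6 * q) *\<^sub>R mat 1) ((q\<^sup>2 - 1) *\<^sub>R phi A) \<in> range spectral"
    unfolding phi spectral_1[symmetric] spectral_scaleR
    using x assms by (subst mfrac_spectral) (auto simp: power2_eq_1_iff)
  moreover have "c *\<^sub>R mat 1 \<in> range spectral" for c
    by (simp add: spectral_scaleR flip: spectral_1)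
  moreover have "c *\<^sub>R mat_pow (phi A) 2 \<in> range spectral" for c
    by (simp only: phi spectral_mat_pow spectral_scaleR rangeI)
  ultimately show ?thesis
    unfolding pow_den'_def Let_def by (metis (full_types) scaleR_one)
qed

lemma ln_den'_spectral:
  assumes phi: "phi A = spectral x" and x: "\<And>b. b \<in> B \<Longrightarrow> x b \<noteq> 0"
  shows "ln_den' A n \<in> range spectral"
proof -
  have "0 \<in> range spectral"
    by (metis rangeI spectral_0)
  moreover have "matrix_inv ((- 2) *\<^sub>R phi A) \<in> range spectral"
    unfolding phi spectral_scaleR using x by (subst matrix_inv_spectral) auto
  moreover have "mfrac (6 *\<^sub>R mat 1) (phi A) \<in> range spectral"
    unfolding phi spectral_1[symmetric] spectral_scaleR using x by (subst mfrac_spectral) auto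
  moreover have "c *\<^sub>R mat 1 \<in> range spectral" for c
    by (simp add: spectral_scaleR flip: spectral_1)
  moreover have "c *\<^sub>R mfrac (d *\<^sub>R mat 1) ((\<Prod>j=1..k. 2 * real j)\<^sup>2 *\<^sub>R phi A) \<in> range spectral"
    for c d k
    unfolding phi spectral_1[symmetric] spectral_scaleR
    using x by (subst mfrac_spectral) (auto simp: spectral_scaleR)
  ultimately show ?thesis
    unfolding ln_den'_def Let_def by (simp only: split: if_split) blast
qed

end

section \<open>The three expansions in an eigenbasis of \<open>A\<close>\<close>

theorem theorem3p1:
  fixes A :: "real^'n^'n" and q :: real
  assumes "2 \<le> CARD('n)"
    and "positive_definite A"
    and "0 < q" and "q < 1"
    and "invertible (phi A)"
  shows "(cf_equals (pow_den q A) ones (mat_powr A q)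
          \<and> cf_equals (ln_den A) ones (mat_ln A)
          \<and> (cf_defined (prod_den (pow_den q A) (ln_den A)) (prod_num (pow_den q A) (ln_den A))
             \<longrightarrow> cf_equals (prod_den (pow_den q A) (ln_den A)) (prod_num (pow_den q A) (ln_den A))
                  (mat_powr A q ** mat_ln A)))
       \<and> (cf_equals (pow_den' q A) ones (mat_powr A q)
          \<and> cf_equals (ln_den' A) ones (mat_ln A)
          \<and> cf_defined (prod_den (pow_den' q A) (ln_den' A)) (prod_num (pow_den' q A) (ln_den' A))
          \<longrightarrow> cf_equals (prod_den (pow_den' q A) (ln_den' A)) (prod_num (pow_den' q A) (ln_den' A))
                (mat_powr A q ** mat_ln A))"
proof -
  obtain B f where "orthonormal_basis B" and A: "A = orthonormal_basis.spectral B f"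
    and f: "\<And>b. b \<in> B \<Longrightarrow> 0 < f b"
    using positive_definite_spectral[OF assms(2)] by blast
  then interpret orthonormal_basis B by simp
  define x where "x b = (1 - f b) / (1 + f b)" for b
  have phi: "phi A = spectral x"
    and powr: "mat_powr A q = spectral (\<lambda>b. exp (q * ln (f b)))"
    and ln: "mat_ln A = spectral (\<lambda>b. ln (f b))"
    unfolding x_def[abs_def] using positive_spectral_ln[OF A] f by blast+
  \<comment> \<open>Invertibility of \<open>phi A\<close> means that 1 is not an eigenvalue of
    \<open>A\<close>; the coefficients divide by \<open>x b\<close>.\<close>
  have x0: "x b \<noteq> 0" if "b \<in> B" for b
    using assms(5) that unfolding phi by (simp add: invertible_spectral_iff)
  \<comment> \<open>Positive numbers are mapped into (-1, 1), and y |-> (1 - y) / (1 + y) is an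
    involution, so the scalar limits are those at \<open>f b\<close>.\<close>
  have x1: "\<bar>x b\<bar> < 1" and fx: "(1 - x b) / (1 + x b) = f b" if "b \<in> B" for b
    using f[OF that] by (simp_all add: x_def field_simps abs_if)
  have pow_den: "pow_den q A = (\<lambda>n. spectral (\<lambda>b. unit_coeff 1 q q (x b) n))"
    by (rule pow_den_spectral) (use assms phi x0 in auto)
  have ln_den: "ln_den A = (\<lambda>n. spectral (\<lambda>b. unit_coeff 0 0 1 (x b) n))"
    by (rule ln_den_spectral) (use phi x0 in auto)
  have ones: "ones = (\<lambda>n. spectral (\<lambda>_. 1))"
    by (simp add: spectral_1)
  have pow: "cf_equals (pow_den q A) ones (mat_powr A q)"
    unfolding ones pow_den powr
  proof (rule cf_equals_spectral)
    fix b assume b: "b \<in> B"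
    note fraction = unit_fraction[OF less_imp_le[OF assms(3)] assms(4) _ x0[OF b] x1[OF b], of q 1]
    show "cden (unit_coeff 1 q q (x b)) (\<lambda>n. 1) n \<noteq> 0" for n
      using assms(3) by (intro fraction(1)) simp
    show "(\<lambda>n. cnum (unit_coeff 1 q q (x b)) (\<lambda>n. 1) n / cden (unit_coeff 1 q q (x b)) (\<lambda>n. 1) n)
        \<longlonglongrightarrow> exp (q * ln (f b))"
      using pade_powr_tendsto[OF assms(3,4) x1[OF b]] assms(3) by (simp add: fraction(2) fx[OF b])
  qed
  have log: "cf_equals (ln_den A) ones (mat_ln A)"
    unfolding ones ln_den ln
  proof (rule cf_equals_spectral)
    fix b assume b: "b \<in> B"
    note fraction = unit_fraction[OF order_refl zero_less_one _ x0[OF b] x1[OF b], of 1 0]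
    show "cden (unit_coeff 0 0 1 (x b)) (\<lambda>n. 1) n \<noteq> 0" for n
      by (intro fraction(1)) simp
    show "(\<lambda>n. cnum (unit_coeff 0 0 1 (x b)) (\<lambda>n. 1) n / cden (unit_coeff 0 0 1 (x b)) (\<lambda>n. 1) n)
        \<longlonglongrightarrow> ln (f b)"
      using pade_ln_tendsto[OF x1[OF b]] by (simp add: fraction(2) fx[OF b])
  qed
  have "pow_den q A n \<in> range spectral" "ln_den A n \<in> range spectral"
    "pow_den' q A n \<in> range spectral" "ln_den' A n \<in> range spectral" for n
  proof -
    show "pow_den' q A n \<in> range spectral"
      by (rule pow_den'_spectral) (use assms phi x0 in auto)
    show "ln_den' A n \<in> range spectral"
      by (rule ln_den'_spectral) (use phi x0 in auto)
  qed (simp_all add: pow_den ln_den)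
  moreover have "pow_den q A 0 = mat 1" "ln_den A 0 = 0" "pow_den' q A 0 = mat 1" "ln_den' A 0 = 0"
    by (simp_all add: pow_den_def ln_den_def pow_den'_def ln_den'_def)
  ultimately show ?thesis
    using pow log by (intro conjI impI) (auto intro: cf_equals_product)
qed

end
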